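(* For a function $r:(0,\infty)\to(0,\infty)$ the following are equivalent: (i) there exists a Bernstein function $0\ne g\sim(a,b,\mu)$ with $r=r[g]$; (ii) the function $t\mapsto t\,r(t)$ is strictly positive, increasing and concave on $(0,\infty)$. Moreover, if (i) holds with $g\sim(a,b,\mu)$, then: (a) $r$ is continuous and decreasing, with $\lim_{t\to\infty}r(t)=a/2$; (b) $\lim_{t\searrow0}t\,r(t)=b$; (c) $t\mapsto t\,r(t)$ is bounded on $(0,\infty)$ if and only if $a=0$ and there is $h\in\mathcal W^+(\mathbb C_+)$ with $g(z)=z\,h(z)$; in this case $h$ is completely monotone.
   Context: A Bernstein function $g\sim(a,b,\mu)$ is $g(z)=a+bz+\int_{(0,\infty)}(1-e^{-sz})\mu(\mathrm ds)$ with $a,b\ge0$, $\mu$ positive Radon on $(0,\infty)$, $\int\frac{s}{1+s}\mu(\mathrm ds)<\infty$; the triple is unique. Rate function: $r[g](t):=\frac a2+\frac bt+\int_{(0,\infty)}\min(s/t,1)\,\mu(\mathrm ds)$, $t>0$. $\mathcal W^+(\mathbb C_+)$: Laplace transforms of bounded complex Radon measures on $[0,\infty)$. A function $h$ on $(0,\infty)$ is completely monotone if $h\in C^\infty$ and $(-1)^nh^{(n)}\ge0$ for all $n\ge0$. *)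

theory Defs
  imports "HOL-Analysis.Analysis"
begin

text \<open>A Bernstein triple (a,b,mu): a,b >= 0, mu a positive Radon measure on (0,oo)
  (a Borel measure on the reals giving no mass to (-oo,0], finite on compact subsets
  of (0,oo)) with integral of s/(1+s) finite.\<close>
definition bernstein_triple :: "real \<Rightarrow> real \<Rightarrow> real measure \<Rightarrow> bool" where
  "bernstein_triple a b \<mu> \<longleftrightarrow>
     a \<ge> 0 \<and> b \<ge> 0 \<and> sets \<mu> = sets borel \<and> emeasure \<mu> {..0} = 0 \<and>
     (\<forall>K. compact K \<and> K \<subseteq> {0<..} \<longrightarrow> emeasure \<mu> K < \<infinity>) \<and>
     integrable \<mu> (\<lambda>s. s / (1 + s))"

definition bernstein_fun :: "real \<Rightarrow> real \<Rightarrow> real measure \<Rightarrow> complex \<Rightarrow> complex" where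
  "bernstein_fun a b \<mu> z =
     complex_of_real a + complex_of_real b * z +
     (\<integral>s. (1 - exp (- (complex_of_real s * z))) \<partial>\<mu>)"

definition rate_fun :: "real \<Rightarrow> real \<Rightarrow> real measure \<Rightarrow> real \<Rightarrow> real" where
  "rate_fun a b \<mu> t = a / 2 + b / t + (\<integral>s. min (s / t) 1 \<partial>\<mu>)"

text \<open>W^+(C_+): Laplace transforms of bounded complex Radon measures on [0,oo).
  A bounded complex measure nu is represented by its polar form f * M with M a finite
  (positive) Borel measure concentrated on [0,oo) and f an M-integrable complex density.\<close>
definition W_plus :: "(complex \<Rightarrow> complex) \<Rightarrow> bool" where
  "W_plus h \<longleftrightarrow>
     (\<exists>(M :: real measure) (f :: real \<Rightarrow> complex).
        finite_measure M \<and> sets M = sets borel \<and> emeasure M {..<0} = 0 \<and>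
        integrable M f \<and>
        (\<forall>z. Re z > 0 \<longrightarrow> h z = (\<integral>s. exp (- (complex_of_real s * z)) * f s \<partial>M)))"

definition completely_monotone :: "(real \<Rightarrow> real) \<Rightarrow> bool" where
  "completely_monotone h \<longleftrightarrow>
     (\<forall>n t. t > 0 \<longrightarrow> ((deriv ^^ n) h) differentiable (at t)) \<and>
     (\<forall>n t. t > 0 \<longrightarrow> (-1) ^ n * (deriv ^^ n) h t \<ge> 0)"

end

theory Submission
  imports Defs
begin

text \<open>Multiplying by \<open>t\<close> turns the rate function into \<open>t r(t) = a t / 2 + b + \<integral> min s t \<mu>(ds)\<close>, an
  integral of concave increasing functions of \<open>t\<close>. Conversely, a nonnegative, increasing and concave
  \<open>\<phi>\<close> is \<open>b + \<integral>\<close> of a decreasing density \<open>D\<close> over \<open>(0, t]\<close>; with \<open>a / 2 = inf D\<close>, the measure \<open>\<mu>\<close> with tail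
  \<open>\<mu>(u, \<infinity>) = D u - a / 2\<close> represents \<open>\<phi>\<close>. Boundedness of \<open>t r(t)\<close> means \<open>a = 0\<close> and
  \<open>\<integral> s \<mu>(ds) < \<infinity>\<close>, in which case \<open>g z / z\<close> is the Laplace transform of a finite positive measure and
  hence completely monotone; in the other direction \<open>r(1 / x) \<le> 2 g x\<close> for real \<open>x\<close>, and \<open>g x / x\<close> is
  bounded since Laplace transforms of finite measures are.\<close>

section \<open>Rate functions\<close>

lemma bernstein_tripleD:
  assumes "bernstein_triple a b \<mu>"
  shows "0 \<le> a" "0 \<le> b" "sets \<mu> = sets borel" "AE s in \<mu>. 0 < s"
    "integrable \<mu> (\<lambda>s. s / (1 + s))"
proof -
  from assms show "0 \<le> a" "0 \<le> b" "sets \<mu> = sets borel" "integrable \<mu> (\<lambda>s. s / (1 + s))"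
    by (auto simp: bernstein_triple_def)
  with assms show "AE s in \<mu>. 0 < s"
    by (intro AE_I[of _ _ "{..0}"]) (auto simp: bernstein_triple_def)
qed

text \<open>The integrability condition on \<open>\<mu>\<close> enters mostly in this form. The
  majorant works because, for \<open>s > 0\<close>, \<open>min s t * (1 + s)\<close> splits into a
  term at most \<open>s\<close> and a term at most \<open>t * s\<close>.\<close>

lemma integrable_min:
  assumes \<mu>: "bernstein_triple a b \<mu>" and t: "0 < t"
  shows "integrable \<mu> (\<lambda>s. min s t)"
proof (rule Bochner_Integration.integrable_bound)
  note [measurable_cong] = bernstein_tripleD(3)[OF \<mu>]
  show "integrable \<mu> (\<lambda>s. (1 + t) * (s / (1 + s)))"
    using bernstein_tripleD(5)[OF \<mu>] by (rule integrable_mult_right)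
  show "(\<lambda>s. min s t) \<in> borel_measurable \<mu>"
    by measurable
  have "norm (min s t) \<le> norm ((1 + t) * (s / (1 + s)))" if "0 < s" for s
  proof -
    have "min s t * (1 + s) \<le> (1 + t) * s"
      using that t by (cases "s \<le> t") (auto simp: min_def algebra_simps)
    then show ?thesis
      using that t by (simp add: pos_le_divide_eq)
  qed
  then show "AE s in \<mu>. norm (min s t) \<le> norm ((1 + t) * (s / (1 + s)))"
    using bernstein_tripleD(4)[OF \<mu>] by auto
qed

lemma min_divide: "0 < t \<Longrightarrow> min (s / t) 1 = min s t / t" for s t :: real
  by (auto simp: min_def field_simps)

lemma mult_rate_fun:
  assumes "0 < t"
  shows "t * rate_fun a b \<mu> t = a / 2 * t + b + (\<integral>s. min s t \<partial>\<mu>)"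
  using assms by (simp add: rate_fun_def min_divide field_simps)

lemma integral_min_nonneg:
  assumes \<mu>: "bernstein_triple a b \<mu>" and t: "0 < t"
  shows "0 \<le> (\<integral>s. min s t \<partial>\<mu>)"
  using bernstein_tripleD(4)[OF \<mu>] t by (intro integral_nonneg_AE) auto

lemma mono_on_integral_min:
  assumes \<mu>: "bernstein_triple a b \<mu>"
  shows "mono_on {0<..} (\<lambda>t. \<integral>s. min s t \<partial>\<mu>)"
  using integrable_min[OF \<mu>] by (intro mono_onI integral_mono) auto

lemma concave_on_integral_min:
  assumes \<mu>: "bernstein_triple a b \<mu>"
  shows "concave_on {0<..} (\<lambda>t. \<integral>s. min s t \<partial>\<mu>)"
proof (intro concave_on_linorderI)
  fix u x y :: real
  assume u: "0 < u" "u < 1" and xy: "x \<in> {0<..}" "y \<in> {0<..}"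
  have "(1 - u) * (\<integral>s. min s x \<partial>\<mu>) + u * (\<integral>s. min s y \<partial>\<mu>)
      = (\<integral>s. (1 - u) * min s x + u * min s y \<partial>\<mu>)"
    using integrable_min[OF \<mu>] xy by simp
  also have "\<dots> \<le> (\<integral>s. min s ((1 - u) *\<^sub>R x + u *\<^sub>R y) \<partial>\<mu>)"
  proof (rule integral_mono)
    have "0 < (1 - u) *\<^sub>R x + u *\<^sub>R y"
      using u xy by (simp add: add_pos_pos)
    then show "integrable \<mu> (\<lambda>s. min s ((1 - u) *\<^sub>R x + u *\<^sub>R y))"
      by (rule integrable_min[OF \<mu>])
    show "(1 - u) * min s x + u * min s y \<le> min s ((1 - u) *\<^sub>R x + u *\<^sub>R y)" for s
    proof -
      have "(1 - u) * min s x \<le> (1 - u) * s" "(1 - u) * min s x \<le> (1 - u) * x"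
        "u * min s y \<le> u * s" "u * min s y \<le> u * y"
        using u by (auto intro!: mult_left_mono)
      then show ?thesis
        by (auto simp: algebra_simps)
    qed
  qed (use integrable_min[OF \<mu>] xy in auto)
  finally show "(1 - u) * (\<integral>s. min s x \<partial>\<mu>) + u * (\<integral>s. min s y \<partial>\<mu>)
      \<le> (\<integral>s. min s ((1 - u) *\<^sub>R x + u *\<^sub>R y) \<partial>\<mu>)" .
qed auto

lemma mono_on_mult_rate_fun:
  assumes \<mu>: "bernstein_triple a b \<mu>"
  shows "mono_on {0<..} (\<lambda>t. t * rate_fun a b \<mu> t)"
proof (rule mono_onI)
  fix x y :: real assume "x \<in> {0<..}" "y \<in> {0<..}" "x \<le> y"
  with mono_onD[OF mono_on_integral_min[OF \<mu>] this] bernstein_tripleD(1)[OF \<mu>]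
  show "x * rate_fun a b \<mu> x \<le> y * rate_fun a b \<mu> y"
    by (simp add: mult_rate_fun add_mono mult_left_mono)
qed

lemma concave_on_mult_rate_fun:
  assumes \<mu>: "bernstein_triple a b \<mu>"
  shows "concave_on {0<..} (\<lambda>t. t * rate_fun a b \<mu> t)"
proof -
  have "concave_on {0<..} (\<lambda>t. a / 2 * t + b + (\<integral>s. min s t \<partial>\<mu>))"
    using bernstein_tripleD(1)[OF \<mu>]
    by (intro concave_on_add concave_on_cmul concave_on_integral_min[OF \<mu>])
       (auto simp: concave_on_ident concave_on_const)
  \<comment> \<open>\<open>mult_rate_fun\<close> may be rewritten only at positive arguments, so
    convex combinations have to stay in the half-line; \<open>u = 0\<close> forces
    \<open>v = 1\<close>.\<close>
  moreover have "0 < u * x + v * y" if "0 < x" "0 < y" "0 \<le> u" "0 \<le> v" "u + v = 1" for u v x y :: real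
    using that by (cases "u = 0") (auto intro: add_pos_nonneg)
  ultimately show ?thesis
    unfolding concave_on_iff by (auto simp: mult_rate_fun)
qed

lemma antimono_on_rate_fun:
  assumes \<mu>: "bernstein_triple a b \<mu>"
  shows "antimono_on {0<..} (rate_fun a b \<mu>)"
proof (rule monotone_onI)
  fix x y :: real assume xy: "x \<in> {0<..}" "y \<in> {0<..}" "x \<le> y"
  have "(\<integral>s. min (s / y) 1 \<partial>\<mu>) \<le> (\<integral>s. min (s / x) 1 \<partial>\<mu>)"
  proof (rule integral_mono_AE)
    show "integrable \<mu> (\<lambda>s. min (s / y) 1)" "integrable \<mu> (\<lambda>s. min (s / x) 1)"
      using integrable_min[OF \<mu>] xy by (auto simp: min_divide)
    \<comment> \<open>Dividing by the larger number decreases the quotient only for positive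
      \<open>s\<close>, hence an almost everywhere comparison of the integrands.\<close>
    have "min (s / y) 1 \<le> min (s / x) 1" if "0 < s" for s
      using xy that by (intro min.mono divide_left_mono) auto
    then show "AE s in \<mu>. min (s / y) 1 \<le> min (s / x) 1"
      using bernstein_tripleD(4)[OF \<mu>] by auto
  qed
  moreover have "b / y \<le> b / x"
    using xy bernstein_tripleD(2)[OF \<mu>] by (intro divide_left_mono) auto
  ultimately show "rate_fun a b \<mu> y \<le> rate_fun a b \<mu> x"
    by (simp add: rate_fun_def)
qed

text \<open>A concave function on an open interval is continuous; this applies to
  \<open>t * rate_fun a b \<mu> t\<close>, and dividing by \<open>t\<close> preserves it. The signs
  come from passing to the convex negative.\<close>

lemma continuous_on_rate_fun:
  assumes \<mu>: "bernstein_triple a b \<mu>"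
  shows "continuous_on {0<..} (rate_fun a b \<mu>)"
proof -
  have "continuous_on {0<..} (\<lambda>t. - (t * rate_fun a b \<mu> t))"
    using concave_on_mult_rate_fun[OF \<mu>]
    by (intro convex_on_continuous) (auto simp: concave_on_def)
  then have "continuous_on {0<..} (\<lambda>t. - (- (t * rate_fun a b \<mu> t)) / t)"
    by (intro continuous_on_divide[OF continuous_on_minus continuous_on_id]) auto
  then show ?thesis
    by (rule continuous_on_eq) auto
qed

text \<open>Dominated convergence: once \<open>t >= 1\<close>, the integrand lies below
  \<open>min s 1\<close> for almost all \<open>s\<close>, and it tends to 0 pointwise.\<close>

lemma tendsto_rate_fun_at_top:
  assumes \<mu>: "bernstein_triple a b \<mu>"
  shows "(rate_fun a b \<mu> \<longlongrightarrow> a / 2) at_top"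
proof -
  note [measurable_cong] = bernstein_tripleD(3)[OF \<mu>]
  have "((\<lambda>t. \<integral>s. min (s / t) 1 \<partial>\<mu>) \<longlongrightarrow> (\<integral>s. 0 \<partial>\<mu>)) at_top"
  proof (rule integral_dominated_convergence_at_top)
    show "integrable \<mu> (\<lambda>s. min s 1)"
      by (rule integrable_min[OF \<mu>]) simp
    have "((\<lambda>t. min (s / t) 1) \<longlongrightarrow> min 0 1) at_top" for s :: real
      by (intro tendsto_min tendsto_const real_tendsto_divide_at_top[OF tendsto_const] filterlim_ident)
    then show "AE s in \<mu>. ((\<lambda>t. min (s / t) 1) \<longlongrightarrow> 0) at_top"
      by simp
    have "norm (min (s / t) 1) \<le> min s 1" if "0 < s" "1 \<le> t" for s t :: real
    proof -
      have "s / t \<le> s / 1"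
        using that by (intro divide_left_mono) auto
      with that show ?thesis by auto
    qed
    then show "\<forall>\<^sub>F t in at_top. AE s in \<mu>. norm (min (s / t) 1) \<le> min s 1"
      using bernstein_tripleD(4)[OF \<mu>]
      by (intro eventually_mono[OF eventually_ge_at_top[of "1::real"]]) auto
  qed measurable
  moreover have "((\<lambda>t. b / t) \<longlongrightarrow> 0) at_top"
    by (intro real_tendsto_divide_at_top[OF tendsto_const] filterlim_ident)
  ultimately have "((\<lambda>t. a / 2 + b / t + (\<integral>s. min (s / t) 1 \<partial>\<mu>)) \<longlongrightarrow> a / 2 + 0 + 0) at_top"
    by (intro tendsto_intros) simp_all
  then show ?thesis
    by (simp add: rate_fun_def[abs_def])
qed

text \<open>Substituting \<open>t = inverse x\<close> moves the limit from 0 to infinity, where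
  dominated convergence with the majorant \<open>min s 1\<close> applies again.\<close>

lemma tendsto_mult_rate_fun_at_right:
  assumes \<mu>: "bernstein_triple a b \<mu>"
  shows "((\<lambda>t. t * rate_fun a b \<mu> t) \<longlongrightarrow> b) (at_right 0)"
proof -
  note [measurable_cong] = bernstein_tripleD(3)[OF \<mu>]
  have "((\<lambda>x. \<integral>s. min s (inverse x) \<partial>\<mu>) \<longlongrightarrow> (\<integral>s. 0 \<partial>\<mu>)) at_top"
  proof (rule integral_dominated_convergence_at_top)
    show "integrable \<mu> (\<lambda>s. min s 1)"
      by (rule integrable_min[OF \<mu>]) simp
    have "((\<lambda>x. min s (inverse x)) \<longlongrightarrow> min s 0) at_top" for s :: real
      by (intro tendsto_intros tendsto_inverse_0_at_top filterlim_ident)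
    then have "((\<lambda>x. min s (inverse x)) \<longlongrightarrow> 0) at_top" if "0 < s" for s :: real
      using that by (metis min.absorb2 less_imp_le)
    then show "AE s in \<mu>. ((\<lambda>x. min s (inverse x)) \<longlongrightarrow> 0) at_top"
      using bernstein_tripleD(4)[OF \<mu>] by auto
    have "norm (min s (inverse x)) \<le> min s 1" if "0 < s" "1 \<le> x" for s x :: real
      using that inverse_le_1_iff[of x] by auto
    then show "\<forall>\<^sub>F x in at_top. AE s in \<mu>. norm (min s (inverse x)) \<le> min s 1"
      using bernstein_tripleD(4)[OF \<mu>]
      by (intro eventually_mono[OF eventually_ge_at_top[of "1::real"]]) auto
  qed measurable
  then have "((\<lambda>t. \<integral>s. min s t \<partial>\<mu>) \<longlongrightarrow> 0) (at_right 0)"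
    by (simp add: filterlim_at_right_to_top)
  then have "((\<lambda>t. a / 2 * t + b + (\<integral>s. min s t \<partial>\<mu>)) \<longlongrightarrow> a / 2 * 0 + b + 0) (at_right 0)"
    by (intro tendsto_intros)
  then have "((\<lambda>t. a / 2 * t + b + (\<integral>s. min s t \<partial>\<mu>)) \<longlongrightarrow> b) (at_right 0)"
    by simp
  then show ?thesis
    by (rule Lim_transform_eventually)
       (use eventually_at_right_less[of "0::real"] in \<open>auto elim!: eventually_mono simp: mult_rate_fun\<close>)
qed

section \<open>Comparison of rate and Bernstein functions; consequences of boundedness\<close>

lemma one_minus_exp_ge_min: "min y 1 / 2 \<le> 1 - exp (- y)" if "0 \<le> y" for y :: real
proof -
  \<comment> \<open>The middle term \<open>y / (1 + y)\<close> is at least \<open>y / 2\<close> up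
    to 1 and at least 1/2 beyond; \<open>1 + y <= exp y\<close> compares it with the
    exponential.\<close>
  have "min y 1 / 2 \<le> y / (1 + y)"
    using that by (cases "y \<le> 1") (auto simp: min_def field_simps mult_left_le)
  also have "\<dots> = 1 - inverse (1 + y)"
    using that by (simp add: field_simps)
  also have "\<dots> \<le> 1 - exp (- y)"
    using that exp_ge_add_one_self[of y] by (simp add: exp_minus le_imp_inverse_le)
  finally show ?thesis .
qed

lemma integrable_one_minus_exp:
  assumes \<mu>: "bernstein_triple a b \<mu>" and x: "0 < x"
  shows "integrable \<mu> (\<lambda>s. 1 - exp (- (s * x)))"
proof (rule Bochner_Integration.integrable_bound)
  note [measurable_cong] = bernstein_tripleD(3)[OF \<mu>]
  \<comment> \<open>This majorant is \<open>min (s * x) 1\<close>, which dominates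
    \<open>1 - exp (- (s * x))\<close> for positive \<open>s\<close>.\<close>
  show "integrable \<mu> (\<lambda>s. x * min s (1 / x))"
    using x by (intro integrable_mult_right integrable_min[OF \<mu>]) auto
  show "(\<lambda>s. 1 - exp (- (s * x))) \<in> borel_measurable \<mu>"
    by measurable
  have "norm (1 - exp (- (s * x))) \<le> norm (x * min s (1 / x))" if "0 < s" for s
    using that x exp_ge_add_one_self[of "- (s * x)"] by (auto simp: min_def field_simps)
  then show "AE s in \<mu>. norm (1 - exp (- (s * x))) \<le> norm (x * min s (1 / x))"
    using bernstein_tripleD(4)[OF \<mu>] by auto
qed

lemma bernstein_fun_of_real:
  "bernstein_fun a b \<mu> (complex_of_real x) = complex_of_real (a + b * x + (\<integral>s. 1 - exp (- (s * x)) \<partial>\<mu>))"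
proof -
  have "(\<integral>s. 1 - exp (- (complex_of_real s * complex_of_real x)) \<partial>\<mu>)
      = (\<integral>s. complex_of_real (1 - exp (- (s * x))) \<partial>\<mu>)"
    by (simp flip: exp_of_real)
  then show ?thesis
    by (simp only: bernstein_fun_def integral_complex_of_real) simp
qed

text \<open>At \<open>t = 1 / x\<close> the ratio \<open>s / t\<close> is \<open>s * x\<close>, so
  \<open>one_minus_exp_ge_min\<close> can be integrated; the terms in \<open>a\<close> and
  \<open>b\<close> only grow. Both the boundedness criterion and the exclusion of
  \<open>g = 0\<close> rest on this estimate.\<close>

lemma rate_fun_inverse_le:
  assumes \<mu>: "bernstein_triple a b \<mu>" and x: "0 < x"
  shows "rate_fun a b \<mu> (1 / x) \<le> 2 * Re (bernstein_fun a b \<mu> (complex_of_real x))"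
proof -
  have "(\<integral>s. min (s / (1 / x)) 1 \<partial>\<mu>) \<le> (\<integral>s. 2 * (1 - exp (- (s * x))) \<partial>\<mu>)"
  proof (rule integral_mono_AE)
    show "integrable \<mu> (\<lambda>s. min (s / (1 / x)) 1)"
      using x integrable_min[OF \<mu>, of "1 / x"] by (subst min_divide) auto
    show "integrable \<mu> (\<lambda>s. 2 * (1 - exp (- (s * x))))"
      by (intro integrable_mult_right integrable_one_minus_exp[OF \<mu> x])
    have "min (s / (1 / x)) 1 \<le> 2 * (1 - exp (- (s * x)))" if "0 < s" for s
      using one_minus_exp_ge_min[of "s * x"] that x by simp
    then show "AE s in \<mu>. min (s / (1 / x)) 1 \<le> 2 * (1 - exp (- (s * x)))"
      using bernstein_tripleD(4)[OF \<mu>] by auto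
  qed
  moreover have "(\<integral>s. 2 * (1 - exp (- (s * x))) \<partial>\<mu>) = 2 * (\<integral>s. 1 - exp (- (s * x)) \<partial>\<mu>)"
    by (rule integral_mult_right_zero)
  moreover have "0 \<le> a" "0 \<le> b * x"
    using bernstein_tripleD(1,2)[OF \<mu>] x by auto
  ultimately show ?thesis
    unfolding rate_fun_def bernstein_fun_of_real Re_complex_of_real by simp
qed

text \<open>The exponential has norm at most 1 for \<open>s >= 0\<close>, so the total variation of
  the complex measure, the integral of \<open>norm (f s)\<close>, serves as the bound.\<close>

lemma W_plus_bounded:
  assumes "W_plus h"
  obtains C where "\<And>z. 0 < Re z \<Longrightarrow> norm (h z) \<le> C"
proof -
  obtain M :: "real measure" and f where M: "sets M = sets borel" "emeasure M {..<0} = 0" "integrable M f"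
    and h: "\<And>z. Re z > 0 \<Longrightarrow> h z = (\<integral>s. exp (- (complex_of_real s * z)) * f s \<partial>M)"
    using assms unfolding W_plus_def by blast
  note [measurable_cong] = M(1)
  have nn: "AE s in M. 0 \<le> s"
    using M by (intro AE_I[of _ _ "{..<0}"]) auto
  have "norm (h z) \<le> (\<integral>s. norm (f s) \<partial>M)" if z: "Re z > 0" for z
  proof -
    have *: "AE s in M. norm (exp (- (complex_of_real s * z)) * f s) \<le> norm (f s)"
      using nn
    proof eventually_elim
      case (elim s)
      then have "exp (- (s * Re z)) * norm (f s) \<le> 1 * norm (f s)"
        using z by (intro mult_right_mono) auto
      then show ?case
        by (simp add: norm_mult)
    qed
    have [measurable]: "f \<in> borel_measurable M"
      using M(3) by auto
    have "integrable M (\<lambda>s. exp (- (complex_of_real s * z)) * f s)"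
      using * by (intro Bochner_Integration.integrable_bound[OF M(3)]) auto
    then show ?thesis
      unfolding h[OF z] using *
      by (intro order_trans[OF integral_norm_bound] integral_mono_AE integrable_norm M(3)) auto
  qed
  then show ?thesis
    by (rule that)
qed

lemma integrable_of_bounded:
  assumes \<mu>: "bernstein_triple a b \<mu>"
    and bdd: "bounded ((\<lambda>t. t * rate_fun a b \<mu> t) ` {0<..})"
  shows "a = 0" "integrable \<mu> (\<lambda>s. s)"
proof -
  note [measurable_cong] = bernstein_tripleD(3)[OF \<mu>]
  obtain B where B': "\<And>t. 0 < t \<Longrightarrow> t * rate_fun a b \<mu> t \<le> B"
    using bdd unfolding bounded_iff by (auto dest!: spec abs_le_D1)
  have B: "a / 2 * t + b + (\<integral>s. min s t \<partial>\<mu>) \<le> B" if "0 < t" for t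
    using B'[OF that] mult_rate_fun[OF that] by metis
  have ab: "0 \<le> a" "0 \<le> b"
    using bernstein_tripleD(1,2)[OF \<mu>] .
  show "a = 0"
  proof (rule ccontr)
    assume "a \<noteq> 0"
    with ab have a: "0 < a" by simp
    \<comment> \<open>At this point the linear term alone equals \<open>\<bar>B\<bar> + 1\<close>,
      more than the bound \<open>B\<close> allows.\<close>
    define t where "t = 2 * (\<bar>B\<bar> + 1) / a"
    have "0 < t" "a / 2 * t = \<bar>B\<bar> + 1"
      using a by (auto simp: t_def)
    with B[of t] integral_min_nonneg[OF \<mu>, of t] ab show False
      by linarith
  qed
  \<comment> \<open>Monotone convergence along the truncation levels 1, 2, ...; the successor keeps
    each level positive, as \<open>integrable_min\<close> requires.\<close>
  let ?I = "\<lambda>n. \<integral>s. min s (real (Suc n)) \<partial>\<mu>"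
  have "incseq ?I"
    using mono_onD[OF mono_on_integral_min[OF \<mu>]] by (auto simp: incseq_def)
  moreover have "?I n \<le> B" for n
    using B[of "real (Suc n)"] ab by (smt (verit) divide_nonneg_nonneg mult_nonneg_nonneg of_nat_0_less_iff zero_less_Suc)
  ultimately obtain L where L: "?I \<longlonglongrightarrow> L"
    using incseq_convergent by blast
  show "integrable \<mu> (\<lambda>s. s)"
  proof (rule integral_monotone_convergence_nonneg[OF _ _ _ _ L])
    show "integrable \<mu> (\<lambda>s. min s (real (Suc n)))" for n
      by (rule integrable_min[OF \<mu>]) simp
    show "AE s in \<mu>. mono (\<lambda>n. min s (real (Suc n)))"
      by (auto simp: mono_def)
    show "AE s in \<mu>. 0 \<le> min s (real (Suc n))" for n
      using bernstein_tripleD(4)[OF \<mu>] by auto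
    have "(\<lambda>n. min s (real (Suc n))) \<longlonglongrightarrow> s" for s :: real
    proof (rule tendsto_eventually)
      show "\<forall>\<^sub>F n in sequentially. min s (real (Suc n)) = s"
        using eventually_ge_at_top[of "nat \<lceil>s\<rceil>"] by eventually_elim (auto simp: min_def; linarith)
    qed
    then show "AE s in \<mu>. (\<lambda>n. min s (real (Suc n))) \<longlonglongrightarrow> s"
      by simp
  qed measurable
qed

section \<open>Concave functions as rate functions\<close>

text \<open>On a partition into \<open>n\<close> equal pieces the bounds on the increments telescope
  to \<open>(t - s) * (D s - D t) / n\<close>, which is arbitrarily small.\<close>

lemma const_of_antimono_increments:
  fixes f D :: "real \<Rightarrow> real"
  assumes st: "s < t"
    and D: "\<And>u v. s \<le> u \<Longrightarrow> u < v \<Longrightarrow> v \<le> t \<Longrightarrow> \<bar>f v - f u\<bar> \<le> (D u - D v) * (v - u)"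
  shows "f t = f s"
proof (rule ccontr)
  assume "f t \<noteq> f s"
  then have pos: "0 < \<bar>f t - f s\<bar>" by simp
  have le: "\<bar>f t - f s\<bar> \<le> (t - s) * (D s - D t) / real n" if n: "0 < n" for n
  proof -
    define p where "p i = s + real i * ((t - s) / real n)" for i
    have p: "p 0 = s" "p n = t" "p (Suc i) - p i = (t - s) / real n" for i
      using n by (simp_all add: p_def add_divide_distrib distrib_right)
    have mono: "p i \<le> p j" if "i \<le> j" for i j
      using that st unfolding p_def by (intro add_left_mono mult_right_mono) auto
    have "\<bar>f t - f s\<bar> = \<bar>\<Sum>i<n. f (p (Suc i)) - f (p i)\<bar>"
      using sum_lessThan_telescope[of "\<lambda>i. f (p i)" n] by (simp add: p(1,2))
    also have "\<dots> \<le> (\<Sum>i<n. \<bar>f (p (Suc i)) - f (p i)\<bar>)"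
      by (rule sum_abs)
    also have "\<dots> \<le> (\<Sum>i<n. (D (p i) - D (p (Suc i))) * ((t - s) / real n))"
    proof (rule sum_mono)
      fix i assume "i \<in> {..<n}"
      then have "p 0 \<le> p i" "p (Suc i) \<le> p n"
        by (auto intro!: mono)
      moreover have "p i < p (Suc i)"
        using p(3)[of i] st n by (simp flip: diff_gt_0_iff_gt[of "p (Suc i)"])
      ultimately show "\<bar>f (p (Suc i)) - f (p i)\<bar> \<le> (D (p i) - D (p (Suc i))) * ((t - s) / real n)"
        using D[of "p i" "p (Suc i)"] p(1,2) p(3)[of i] by simp
    qed
    also have "\<dots> = (t - s) / real n * (\<Sum>i<n. D (p i) - D (p (Suc i)))"
      by (simp add: sum_distrib_left mult.commute)
    also have "(\<Sum>i<n. D (p i) - D (p (Suc i))) = D s - D t"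
      using sum_lessThan_telescope'[of "\<lambda>i. D (p i)" n] by (simp add: p)
    finally show ?thesis by simp
  qed
  have "(\<lambda>n. (t - s) * (D s - D t) / real n) \<longlonglongrightarrow> 0"
    by (intro real_tendsto_divide_at_top[OF tendsto_const] filterlim_real_sequentially)
  from order_tendstoD(2)[OF this pos] eventually_gt_at_top[of 0]
  have "\<forall>\<^sub>F n in sequentially. False"
  proof eventually_elim
    case (elim n)
    with le[of n] show False
      by linarith
  qed
  then show False by simp
qed

text \<open>The one-sided slope of a concave function is a density for it; comparing increments on a fine
  partition makes this independent of any differentiability of the function.\<close>

lemma concave_has_integral:
  fixes \<phi> :: "real \<Rightarrow> real"
  assumes mono: "mono_on {0<..} \<phi>" and conc: "concave_on {0<..} \<phi>"
  obtains D where "antimono_on {0<..} D" "\<And>u. 0 < u \<Longrightarrow> 0 \<le> D u"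
    "\<And>s t. 0 < s \<Longrightarrow> s < t \<Longrightarrow> (D has_integral (\<phi> t - \<phi> s)) {s..t}"
proof -
  define S where "S u v = (\<phi> v - \<phi> u) / (v - u)" for u v
  \<comment> \<open>Slopes of adjacent chords decrease: concavity is applied to \<open>w\<close> as
    a convex combination of \<open>u\<close> and \<open>v\<close> with weight
    \<open>l\<close>.\<close>
  have S1: "S w v \<le> S u w" if "0 < u" "u < w" "w < v" for u v w
  proof -
    define l where "l = (w - u) / (v - u)"
    have l: "0 \<le> l" "l \<le> 1" "(1 - l) *\<^sub>R u + l *\<^sub>R v = w"
      using that by (auto simp: l_def divide_simps) (simp add: algebra_simps)
    have "(1 - l) * \<phi> u + l * \<phi> v \<le> \<phi> w"
      using concave_onD[OF conc l(1,2), of u v] that l(3) by simp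
    then have "((v - w) * \<phi> u + (w - u) * \<phi> v) / (v - u) \<le> \<phi> w"
      using that by (simp add: l_def divide_simps split: if_splits)
    then have "(v - w) * \<phi> u + (w - u) * \<phi> v \<le> \<phi> w * (v - u)"
      using that by (simp add: pos_divide_le_eq)
    then show ?thesis
      using that by (simp add: S_def divide_simps) (simp add: algebra_simps)
  qed
  \<comment> \<open>By concavity this supremum is the right derivative at \<open>u\<close>. It is
    finite because a chord to the left of \<open>u\<close>, here starting at \<open>u / 2\<close>,
    is steeper than every chord to the right.\<close>
  define D where "D u = (SUP v\<in>{u<..}. S u v)" for u
  have bdd: "bdd_above (S u ` {u<..})" if "0 < u" for u
    using S1[of "u / 2" u] that by (intro bdd_aboveI2[of _ _ "S (u / 2) u"]) auto
  \<comment> \<open>Together with \<open>D_le_S\<close> this sandwiches each chord slope between the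
    values of \<open>D\<close> at its ends, which yields both the monotonicity of \<open>D\<close>
    and the increment estimate below.\<close>
  have S_le_D: "S u v \<le> D u" if "0 < u" "u < v" for u v
    unfolding D_def using that bdd by (intro cSUP_upper) auto
  have D_le_S: "D v \<le> S u v" if "0 < u" "u < v" for u v
    unfolding D_def using that S1 by (intro cSUP_least) auto
  have anti: "antimono_on {0<..} D"
  proof (rule monotone_onI)
    fix u v :: real assume "u \<in> {0<..}" "v \<in> {0<..}" "u \<le> v"
    then show "D v \<le> D u"
      using S_le_D[of u v] D_le_S[of u v] by (cases "u = v") auto
  qed
  have nonneg: "0 \<le> D u" if "0 < u" for u
  proof -
    have "0 \<le> S u (u + 1)"
      using mono_onD[OF mono, of u "u + 1"] that by (simp add: S_def)
    then show ?thesis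
      using S_le_D[of u "u + 1"] that by simp
  qed
  have "(D has_integral (\<phi> t - \<phi> s)) {s..t}" if st: "0 < s" "s < t" for s t
  proof -
    have int: "D integrable_on {u..v}" if "0 < u" for u v
    proof -
      have "(\<lambda>x. - D x) integrable_on {u..v}"
        using anti that by (intro integrable_on_mono_on) (auto simp: monotone_on_def)
      then show ?thesis
        using integrable_neg_iff by blast
    qed
    define J where "J v = integral {s..v} D" for v
    have J: "J v - J u = integral {u..v} D" if "s \<le> u" "u \<le> v" for u v
      using Henstock_Kurzweil_Integration.integral_combine[OF that int[OF st(1)]] by (simp add: J_def)
    \<comment> \<open>The increments of \<open>\<phi>\<close> and \<open>J\<close> over
      \<open>{u..v}\<close> both lie between \<open>D v * (v - u)\<close> and
      \<open>D u * (v - u)\<close>, so they differ by at most the length of that range.\<close>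
    have "\<phi> t - J t = \<phi> s - J s"
    proof (rule const_of_antimono_increments[OF st(2)])
      fix u v assume uv: "s \<le> u" "u < v" "v \<le> t"
      then have u: "0 < u" using st by simp
      have "integral {u..v} D \<le> integral {u..v} (\<lambda>_. D u)"
        using u uv monotone_onD[OF anti] by (intro integral_le int) auto
      moreover have "integral {u..v} (\<lambda>_. D v) \<le> integral {u..v} D"
        using u uv monotone_onD[OF anti] by (intro integral_le int) auto
      ultimately have "D v * (v - u) \<le> J v - J u" "J v - J u \<le> D u * (v - u)"
        using uv J[of u v] by (auto simp: mult.commute)
      moreover have "\<phi> v - \<phi> u = S u v * (v - u)"
        using uv by (simp add: S_def)
      moreover have "D v * (v - u) \<le> S u v * (v - u)" "S u v * (v - u) \<le> D u * (v - u)"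
        using S_le_D[OF u uv(2)] D_le_S[OF u uv(2)] uv by (auto intro!: mult_right_mono)
      ultimately show "\<bar>\<phi> v - J v - (\<phi> u - J u)\<bar> \<le> (D u - D v) * (v - u)"
        by (simp add: left_diff_distrib abs_le_iff)
    qed
    then have "integral {s..t} D = \<phi> t - \<phi> s"
      by (simp add: J_def)
    then show ?thesis
      using int[OF st(1)] by (metis integrable_integral)
  qed
  with anti nonneg show ?thesis
    by (rule that)
qed

section \<open>Monotone functions near 0 and measures with a prescribed tail\<close>

lemma mono_on_tendsto_Inf:
  fixes \<phi> :: "real \<Rightarrow> real"
  assumes mono: "mono_on {0<..} \<phi>" and nonneg: "\<And>t. 0 < t \<Longrightarrow> 0 \<le> \<phi> t"
  defines "b \<equiv> Inf (\<phi> ` {0<..})"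
  shows "0 \<le> b" "(\<phi> \<longlongrightarrow> b) (at_right 0)"
proof -
  have bdd: "bdd_below (\<phi> ` {0<..})"
    using nonneg by (intro bdd_belowI2[of _ 0]) auto
  show "0 \<le> b"
    unfolding b_def using nonneg by (intro cINF_greatest) auto
  have le: "b \<le> \<phi> t" if "0 < t" for t
    unfolding b_def using that by (intro cINF_lower bdd) auto
  show "(\<phi> \<longlongrightarrow> b) (at_right 0)"
  proof (rule order_tendstoI)
    fix c assume c: "c < b"
    show "\<forall>\<^sub>F t in at_right 0. c < \<phi> t"
      using eventually_at_right_less by (rule eventually_mono) (rule less_le_trans[OF c le])
  next
    fix c assume "b < c"
    then obtain x where x: "0 < x" "\<phi> x < c"
      unfolding b_def using bdd by (subst (asm) cINF_less_iff) auto
    have "\<phi> t < c" if "0 < t" "t < x" for t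
      using mono_onD[OF mono, of t x] that x by simp
    then show "\<forall>\<^sub>F t in at_right 0. \<phi> t < c"
      using eventually_at_rightI[of 0 x "\<lambda>t. \<phi> t < c"] x by auto
  qed
qed

text \<open>Nothing is known of \<open>E\<close> outside the positive half-line, so it is cut off
  there; on the half-line its negative is monotone.\<close>

lemma borel_measurable_antimono_on_pos:
  fixes E :: "real \<Rightarrow> real"
  assumes "antimono_on {0<..} E"
  shows "(\<lambda>u. if 0 < u then E u else 0) \<in> borel_measurable borel"
proof -
  have "(\<lambda>u. - E u) \<in> borel_measurable (restrict_space borel {0<..})"
    using assms by (intro borel_measurable_mono_on_fnc) (auto simp: monotone_on_def)
  then have "E \<in> borel_measurable (restrict_space borel {0<..})"
    using borel_measurable_uminus_eq by blast
  then show ?thesis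
    by (subst (asm) measurable_restrict_space_iff[where c=0]) auto
qed

text \<open>Exhausts \<open>(0, t]\<close> by the intervals \<open>[p n, t]\<close> with
  \<open>p n\<close> decreasing to 0: the left side follows by monotone convergence, the right side
  because \<open>\<psi> (p n)\<close> tends to \<open>b\<close>.\<close>

lemma nn_integral_has_integral_pos:
  fixes E :: "real \<Rightarrow> real"
  assumes E: "\<And>u. 0 < u \<Longrightarrow> 0 \<le> E u"
    and meas: "(\<lambda>u. if 0 < u then E u else 0) \<in> borel_measurable borel"
    and int: "\<And>s. 0 < s \<Longrightarrow> s < t \<Longrightarrow> (E has_integral (\<psi> t - \<psi> s)) {s..t}"
    and t: "0 < t" and lim: "(\<psi> \<longlongrightarrow> b) (at_right 0)"
  shows "(\<integral>\<^sup>+u. ennreal (if 0 < u \<and> u \<le> t then E u else 0) \<partial>lborel) = ennreal (\<psi> t - b)"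
proof -
  \<comment> \<open>The summand 2 gives \<open>p n < t\<close> already for \<open>n = 0\<close>, so
    every interval is nondegenerate.\<close>
  define p where "p n = t / (2 + real n)" for n
  define f where "f n u = (if p n \<le> u \<and> u \<le> t then E u else 0)" for n u
  have p: "0 < p n" "p n < t" for n
    using t by (auto simp: p_def divide_less_eq add_pos_nonneg)
  have p0: "p \<longlonglongrightarrow> 0"
    unfolding p_def
    by (intro real_tendsto_divide_at_top[OF tendsto_const]
        filterlim_tendsto_add_at_top[OF tendsto_const] filterlim_real_sequentially)
  have "(\<lambda>n. \<integral>\<^sup>+u. ennreal (f n u) \<partial>lborel) \<longlonglongrightarrow> (\<integral>\<^sup>+u. ennreal (if 0 < u \<and> u \<le> t then E u else 0) \<partial>lborel)"
  proof (rule nn_integral_LIMSEQ)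
    have "p n \<le> p m" if "m \<le> n" for m n
      using that t by (auto simp: p_def intro!: divide_left_mono mult_pos_pos add_pos_nonneg)
    then have "f m u \<le> f n u" if "m \<le> n" for m n u
      using E[of u] p(1)[of n] that order_trans[of "p n" "p m" u] by (auto simp: f_def)
    then show "incseq (\<lambda>n u. ennreal (f n u))"
      by (auto simp: incseq_def le_fun_def intro!: ennreal_leI)
    have "f n = (\<lambda>u. if p n \<le> u \<and> u \<le> t then (if 0 < u then E u else 0) else 0)" for n
      using p(1)[of n] by (auto simp: f_def fun_eq_iff)
    then show "(\<lambda>u. ennreal (f n u)) \<in> borel_measurable lborel" for n
      using meas by simp
    fix u
    have "\<forall>\<^sub>F n in sequentially. f n u = (if 0 < u \<and> u \<le> t then E u else 0)"
    proof (cases "0 < u")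
      case True
      from order_tendstoD(2)[OF p0 this] show ?thesis
        by eventually_elim (use True in \<open>auto simp: f_def\<close>)
    next
      case False
      with p(1) show ?thesis
        by (intro always_eventually) (auto simp: f_def dest: order.strict_trans2)
    qed
    then show "(\<lambda>n. ennreal (f n u)) \<longlonglongrightarrow> ennreal (if 0 < u \<and> u \<le> t then E u else 0)"
      by (intro tendsto_eventually) (auto elim!: eventually_mono)
  qed
  moreover have "(\<integral>\<^sup>+u. ennreal (f n u) \<partial>lborel) = ennreal (\<psi> t - \<psi> (p n))" for n
  proof -
    have "(\<integral>\<^sup>+u. ennreal (indicator {p n..t} u * E u) \<partial>lborel) = ennreal (\<psi> t - \<psi> (p n))"
      using p[of n] E by (intro nn_integral_has_integral_lebesgue int) auto
    moreover have "indicator {p n..t} u * E u = f n u" for u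
      by (auto simp: f_def indicator_def)
    ultimately show ?thesis by simp
  qed
  moreover have "(\<lambda>n. ennreal (\<psi> t - \<psi> (p n))) \<longlonglongrightarrow> ennreal (\<psi> t - b)"
  proof -
    have "filterlim p (at_right 0) sequentially"
      using p0 p(1) by (intro tendsto_imp_filterlim_at_right) auto
    then have "(\<lambda>n. \<psi> (p n)) \<longlonglongrightarrow> b"
      by (rule filterlim_compose[OF lim])
    then show ?thesis
      by (intro tendsto_intros)
  qed
  ultimately show ?thesis
    using LIMSEQ_unique by auto
qed

text \<open>\<open>\<mu>\<close> is the image of Lebesgue measure under the generalised inverse \<open>G\<close> of \<open>E\<close>, and both sides
  compute the area of the region below the graph of \<open>E\<close> over \<open>(0, t]\<close>.\<close>

lemma exists_measure_of_antimono:
  fixes E :: "real \<Rightarrow> real"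
  assumes anti: "antimono_on {0<..} E"
    and small: "\<And>y. 0 < y \<Longrightarrow> \<exists>u>0. E u < y"
    and nonneg: "\<And>u. 0 < u \<Longrightarrow> 0 \<le> E u"
  shows "\<exists>\<mu> :: real measure. sets \<mu> = sets borel \<and> emeasure \<mu> {..0} = 0 \<and>
    (\<forall>t>0. (\<integral>\<^sup>+s. ennreal (min s t) \<partial>\<mu>) = (\<integral>\<^sup>+u. ennreal (if 0 < u \<and> u \<le> t then E u else 0) \<partial>lborel))"
proof -
  define E' where "E' u = (if 0 < u then E u else 0)" for u
  have [measurable]: "E' \<in> borel_measurable borel"
    unfolding E'_def using anti by (rule borel_measurable_antimono_on_pos)
  define S where "S y = {u. 0 < u \<and> y < E u}" for y
  \<comment> \<open>The inserted 0 handles heights that \<open>E\<close> never exceeds;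
    \<open>small\<close> bounds the set from above at every positive height.\<close>
  define G where "G y = Sup (insert 0 (S y))" for y
  define G' where "G' y = (if 0 < y then G y else 0)" for y
  have bdd: "bdd_above (insert 0 (S y))" if "0 < y" for y
  proof -
    obtain u0 where u0: "0 < u0" "E u0 < y"
      using small[OF \<open>0 < y\<close>] by blast
    have "u \<le> u0" if "u \<in> S y" for u
    proof (rule ccontr)
      assume "\<not> u \<le> u0"
      with monotone_onD[OF anti, of u0 u] u0 have "E u \<le> E u0" by simp
      with u0 that show False by (simp add: S_def)
    qed
    then show ?thesis
      using u0 by (intro bdd_aboveI[of _ u0]) auto
  qed
  have G_nonneg: "0 \<le> G y" if "0 < y" for y
    unfolding G_def using bdd[OF that] by (intro cSup_upper) auto
  have "antimono_on {0<..} G"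
    unfolding G_def S_def[abs_def] using bdd[unfolded S_def]
    by (intro monotone_onI cSup_subset_mono) auto
  then have [measurable]: "G' \<in> borel_measurable borel"
    unfolding G'_def by (rule borel_measurable_antimono_on_pos)
  \<comment> \<open>Whether the right endpoint belongs to the slice depends on one-sided continuity
    of \<open>E\<close>. Lebesgue measure does not see it, so the slice is squeezed between an open
    and a closed interval.\<close>
  have slice: "emeasure lborel {u. 0 < u \<and> u \<le> t \<and> y < E' u} = ennreal (min (G y) t)"
    if "0 < t" "0 < y" for t y
  proof -
    let ?A = "{u. 0 < u \<and> u \<le> t \<and> y < E' u}"
    have "u \<in> ?A" if u: "0 < u" "u < G y" "u < t" for u
    proof -
      obtain v where v: "v \<in> S y" "u < v"
        using u bdd[OF \<open>0 < y\<close>] unfolding G_def by (subst (asm) less_cSup_iff) auto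
      then have "E v \<le> E u"
        using u monotone_onD[OF anti, of u v] by simp
      then show ?thesis
        using v u by (simp add: S_def E'_def)
    qed
    then have 1: "{0<..<min (G y) t} \<subseteq> ?A"
      by auto
    have 2: "?A \<subseteq> {0..min (G y) t}"
      using bdd[OF \<open>0 < y\<close>] by (auto simp: G_def S_def E'_def intro!: cSup_upper)
    have [measurable]: "?A \<in> sets lborel"
      by measurable
    have "0 \<le> min (G y) t"
      using G_nonneg[OF that(2)] that by simp
    then show ?thesis
      using emeasure_mono[OF 1, of lborel] emeasure_mono[OF 2, of lborel] by simp
  qed
  \<comment> \<open>Heights sent to 0, which include all \<open>y <= 0\<close>, are discarded before
    taking the image; otherwise they would put infinite mass at 0.\<close>
  define \<mu> where "\<mu> = distr (density lborel (indicator {y. 0 < G' y})) borel G'"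
  have "(\<integral>\<^sup>+s. ennreal (min s t) \<partial>\<mu>) = (\<integral>\<^sup>+u. ennreal (if 0 < u \<and> u \<le> t then E u else 0) \<partial>lborel)"
    if t: "0 < t" for t
  proof -
    \<comment> \<open>\<open>R\<close> is the indicator of the region under the graph over
      \<open>(0, t]\<close>. Horizontal slices give the integral against \<open>\<mu>\<close>,
      vertical ones the integral of \<open>E\<close>, and Tonelli equates them.\<close>
    define R :: "real \<Rightarrow> real \<Rightarrow> ennreal"
      where "R y u = indicator {(y, u). 0 < y \<and> y < E' u \<and> 0 < u \<and> u \<le> t} (y, u)" for y u
    have "(\<integral>\<^sup>+s. ennreal (min s t) \<partial>\<mu>) = (\<integral>\<^sup>+y. indicator {y. 0 < G' y} y * ennreal (min (G' y) t) \<partial>lborel)"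
      unfolding \<mu>_def by (subst nn_integral_distr, simp, simp, subst nn_integral_density) auto
    also have "\<dots> = (\<integral>\<^sup>+y. \<integral>\<^sup>+u. R y u \<partial>lborel \<partial>lborel)"
    proof (rule nn_integral_cong)
      fix y :: real
      show "indicator {y. 0 < G' y} y * ennreal (min (G' y) t) = (\<integral>\<^sup>+u. R y u \<partial>lborel)"
      proof (cases "0 < y")
        case True
        have "(\<integral>\<^sup>+u. R y u \<partial>lborel) = (\<integral>\<^sup>+u. indicator {u. 0 < u \<and> u \<le> t \<and> y < E' u} u \<partial>lborel)"
          using True by (intro nn_integral_cong) (auto simp: R_def indicator_def)
        also have "\<dots> = ennreal (min (G y) t)"
          using slice[OF t True] by (subst nn_integral_indicator) auto
        finally show ?thesis
          using True G_nonneg[OF True] t by (auto simp: G'_def indicator_def min_def)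
      qed (simp add: R_def G'_def)
    qed
    also have "\<dots> = (\<integral>\<^sup>+u. \<integral>\<^sup>+y. R y u \<partial>lborel \<partial>lborel)"
      unfolding R_def by (rule lborel_pair.Fubini'[symmetric]) measurable
    also have "\<dots> = (\<integral>\<^sup>+u. ennreal (if 0 < u \<and> u \<le> t then E u else 0) \<partial>lborel)"
    proof (rule nn_integral_cong)
      fix u :: real
      show "(\<integral>\<^sup>+y. R y u \<partial>lborel) = ennreal (if 0 < u \<and> u \<le> t then E u else 0)"
      proof (cases "0 < u \<and> u \<le> t")
        case True
        have "(\<integral>\<^sup>+y. R y u \<partial>lborel) = (\<integral>\<^sup>+y. indicator {0<..<E u} y \<partial>lborel)"
          using True by (intro nn_integral_cong) (auto simp: R_def E'_def indicator_def)
        also have "\<dots> = ennreal (E u)"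
          using True nonneg[of u] by simp
        finally show ?thesis
          using True by simp
      qed (auto simp: R_def)
    qed
    finally show ?thesis .
  qed
  moreover have "emeasure \<mu> {..0} = 0"
  proof -
    have "emeasure \<mu> {..0} = (\<integral>\<^sup>+s. indicator {..0} s \<partial>\<mu>)"
      by (simp add: \<mu>_def)
    also have "\<dots> = (\<integral>\<^sup>+y. indicator {y. 0 < G' y} y * indicator {..0} (G' y) \<partial>lborel)"
      unfolding \<mu>_def by (subst nn_integral_distr, simp, simp, subst nn_integral_density) auto
    also have "\<dots> = (\<integral>\<^sup>+(y::real). 0 \<partial>lborel)"
      by (intro nn_integral_cong) (auto simp: indicator_def)
    finally show ?thesis by simp
  qed
  ultimately show ?thesis
    by (intro exI[of _ \<mu>]) (auto simp: \<mu>_def)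
qed

text \<open>One finite integral controls both conditions: \<open>s / (1 + s) <= min s 1\<close> for
  positive \<open>s\<close>, and on a compact set with least element \<open>d > 0\<close> the
  function \<open>min s 1\<close> is at least \<open>min d 1\<close>.\<close>

lemma bernstein_tripleI:
  assumes "0 \<le> a" "0 \<le> b" and sets: "sets \<mu> = sets borel" and null: "emeasure \<mu> {..0} = 0"
    and fin: "(\<integral>\<^sup>+s. ennreal (min s 1) \<partial>\<mu>) < \<infinity>"
  shows "bernstein_triple a b \<mu>"
  unfolding bernstein_triple_def
proof (intro conjI allI impI)
  note [measurable_cong] = sets
  have pos: "AE s in \<mu>. 0 < s"
    using sets null by (intro AE_I[of _ _ "{..0}"]) auto
  show "integrable \<mu> (\<lambda>s. s / (1 + s))"
  proof (rule integrableI_bounded)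
    have "norm (s / (1 + s)) \<le> min s 1" if "0 < s" for s :: real
      using that by (auto simp: min_def field_simps)
    then have "(\<integral>\<^sup>+s. ennreal (norm (s / (1 + s))) \<partial>\<mu>) \<le> (\<integral>\<^sup>+s. ennreal (min s 1) \<partial>\<mu>)"
      using pos by (intro nn_integral_mono_AE) (auto intro!: ennreal_leI)
    with fin show "(\<integral>\<^sup>+s. ennreal (norm (s / (1 + s))) \<partial>\<mu>) < \<infinity>"
      by (rule le_less_trans[rotated])
  qed measurable
  show "emeasure \<mu> K < \<infinity>" if K: "compact K \<and> K \<subseteq> {0<..}" for K
  proof (cases "K = {}")
    case False
    then obtain d where d: "d \<in> K" "\<forall>s\<in>K. d \<le> s"
      using K compact_attains_inf[of K] by metis
    then have d0: "0 < min d 1" using K by auto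
    have [measurable]: "K \<in> sets \<mu>"
      using K sets by (simp add: compact_imp_closed borel_closed)
    have "emeasure \<mu> K = (\<integral>\<^sup>+s. indicator K s \<partial>\<mu>)"
      by simp
    also have "\<dots> \<le> (\<integral>\<^sup>+s. ennreal (1 / min d 1) * ennreal (min s 1) \<partial>\<mu>)"
    proof (rule nn_integral_mono)
      fix s
      show "indicator K s \<le> ennreal (1 / min d 1) * ennreal (min s 1)"
      proof (cases "s \<in> K")
        case True
        then have "min d 1 \<le> min s 1"
          using d(2) by (intro min.mono) auto
        then have "1 \<le> 1 / min d 1 * min s 1"
          by (simp only: times_divide_eq_left mult_1_left pos_le_divide_eq[OF d0])
        then have "ennreal 1 \<le> ennreal (1 / min d 1 * min s 1)"
          by (rule ennreal_leI)
        also have "\<dots> = ennreal (1 / min d 1) * ennreal (min s 1)"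
          using d0 by (intro ennreal_mult') simp
        finally show ?thesis
          using True by simp
      qed simp
    qed
    also have "\<dots> = ennreal (1 / min d 1) * (\<integral>\<^sup>+s. ennreal (min s 1) \<partial>\<mu>)"
      by (rule nn_integral_cmult) measurable
    also have "\<dots> < \<infinity>"
      using fin by (simp add: ennreal_mult_less_top)
    finally show ?thesis .
  qed simp
qed (fact assms)+

lemma exists_bernstein_triple:
  assumes pos: "\<And>t. 0 < t \<Longrightarrow> 0 \<le> \<phi> t"
    and mono: "mono_on {0<..} \<phi>" and conc: "concave_on {0<..} \<phi>"
  obtains a b \<mu> where "bernstein_triple a b \<mu>" "\<And>t. 0 < t \<Longrightarrow> \<phi> t = t * rate_fun a b \<mu> t"
proof -
  obtain D where D: "antimono_on {0<..} D" "\<And>u. 0 < u \<Longrightarrow> 0 \<le> D u"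
    "\<And>s t. 0 < s \<Longrightarrow> s < t \<Longrightarrow> (D has_integral (\<phi> t - \<phi> s)) {s..t}"
    using concave_has_integral[OF mono conc] by blast
  obtain b where b: "0 \<le> b" "(\<phi> \<longlongrightarrow> b) (at_right 0)"
    using mono_on_tendsto_Inf[OF mono pos] by blast
  \<comment> \<open>The infimum of the decreasing \<open>D\<close> is its limit at infinity.
    Subtracting it leaves a function vanishing at infinity, as the tail of a measure must; the rate
    function contains \<open>a / 2\<close>, so \<open>a\<close> becomes
    \<open>2 * \<alpha>\<close>.\<close>
  define \<alpha> where "\<alpha> = Inf (D ` {0<..})"
  have bdd: "bdd_below (D ` {0<..})"
    using D(2) by (intro bdd_belowI2[of _ 0]) auto
  have \<alpha>: "0 \<le> \<alpha>" "\<And>u. 0 < u \<Longrightarrow> \<alpha> \<le> D u"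
    unfolding \<alpha>_def using D(2) by (auto intro!: cINF_greatest cINF_lower bdd)
  define E where "E u = D u - \<alpha>" for u
  have anti: "antimono_on {0<..} E"
    using D(1) by (auto simp: monotone_on_def E_def)
  have E: "0 \<le> E u" if "0 < u" for u
    using \<alpha>(2)[OF that] by (simp add: E_def)
  have small: "\<exists>u>0. E u < y" if "0 < y" for y
  proof -
    have "Inf (D ` {0<..}) < \<alpha> + y"
      using that by (simp add: \<alpha>_def)
    then show ?thesis
      using bdd by (subst (asm) cINF_less_iff) (auto simp: E_def algebra_simps)
  qed
  obtain \<mu> :: "real measure" where \<mu>: "sets \<mu> = sets borel" "emeasure \<mu> {..0} = 0"
    "\<And>t. 0 < t \<Longrightarrow> (\<integral>\<^sup>+s. ennreal (min s t) \<partial>\<mu>) = (\<integral>\<^sup>+u. ennreal (if 0 < u \<and> u \<le> t then E u else 0) \<partial>lborel)"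
    using exists_measure_of_antimono[OF anti small E] by blast
  define \<psi> where "\<psi> t = \<phi> t - \<alpha> * t" for t
  have lim: "(\<psi> \<longlongrightarrow> b) (at_right 0)"
    using tendsto_diff[OF b(2) tendsto_mult_left[OF tendsto_ident_at], of \<alpha>] by (simp add: \<psi>_def[abs_def])
  have int: "(E has_integral (\<psi> t - \<psi> s)) {s..t}" if "0 < s" "s < t" for s t
    using has_integral_diff[OF D(3)[OF that] has_integral_const_real[of \<alpha> s t]] that
    by (simp add: \<psi>_def E_def[abs_def] algebra_simps)
  have nn: "(\<integral>\<^sup>+s. ennreal (min s t) \<partial>\<mu>) = ennreal (\<psi> t - b)" if "0 < t" for t
    unfolding \<mu>(3)[OF that]
    by (rule nn_integral_has_integral_pos[OF E borel_measurable_antimono_on_pos[OF anti] int that lim])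
  have triple: "bernstein_triple (2 * \<alpha>) b \<mu>"
    using \<alpha>(1) b(1) \<mu>(1,2) nn[of 1] by (intro bernstein_tripleI) auto
  have "\<phi> t = t * rate_fun (2 * \<alpha>) b \<mu> t" if t: "0 < t" for t
  proof -
    \<comment> \<open>\<open>ennreal\<close> sends negative reals to 0, so this sign is needed to
      read a real integral off \<open>nn\<close>.\<close>
    have "b \<le> \<psi> t"
    proof (rule tendsto_upperbound[OF lim])
      have "\<psi> s \<le> \<psi> t" if "0 < s" "s < t" for s
        using has_integral_nonneg[OF int[OF that]] E that by simp
      then show "\<forall>\<^sub>F s in at_right 0. \<psi> s \<le> \<psi> t"
        using t by (auto intro!: eventually_at_rightI[of 0 t])
    qed simp
    note [measurable_cong] = \<mu>(1)
    have "has_bochner_integral \<mu> (\<lambda>s. min s t) (\<psi> t - b)"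
      using bernstein_tripleD(4)[OF triple] t nn[OF t] \<open>b \<le> \<psi> t\<close>
      by (intro has_bochner_integral_nn_integral) auto
    then have "(\<integral>s. min s t \<partial>\<mu>) = \<psi> t - b"
      by (rule has_bochner_integral_integral_eq)
    then show ?thesis
      unfolding mult_rate_fun[OF t] by (simp add: \<psi>_def)
  qed
  with triple show ?thesis
    by (rule that)
qed

text \<open>Shows that a triple with positive rate function has a nonzero Bernstein function, as
  required in (i).\<close>

lemma rate_fun_1_nonpos:
  assumes \<mu>: "bernstein_triple a b \<mu>"
    and zero: "\<And>z. 0 < Re z \<Longrightarrow> bernstein_fun a b \<mu> z = 0"
  shows "rate_fun a b \<mu> 1 \<le> 0"
  using rate_fun_inverse_le[OF \<mu>, of 1] zero[of 1] by simp

section \<open>Laplace transforms\<close>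

text \<open>Constructs \<open>N\<close> plus \<open>c\<close> times the point mass at
  \<open>x\<close>. An atom of mass \<open>b\<close> at 0 will account for the linear term of the
  Bernstein function.\<close>

lemma exists_measure_add_atom:
  fixes N :: "real measure" and c x :: real
  assumes fin: "finite_measure N" and sets: "sets N = sets borel" and c: "0 \<le> c"
  shows "\<exists>M. finite_measure M \<and> sets M = sets borel \<and>
    (\<forall>A\<in>sets borel. emeasure M A = emeasure N A + ennreal c * indicator A x)"
proof -
  let ?m = "\<lambda>A. emeasure N A + ennreal c * indicator A x"
  define M where "M = measure_of UNIV (sets borel) ?m"
  have [simp]: "sets M = sets borel"
    using sets.sigma_sets_eq[of "borel :: real measure"] by (simp add: M_def)
  have eq: "emeasure M A = ?m A" if "A \<in> sets borel" for A
    unfolding M_def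
  proof (rule emeasure_measure_of_sigma[OF _ _ _ that])
    show "sigma_algebra UNIV (sets (borel :: real measure))"
      using sets.sigma_algebra_axioms[of "borel :: real measure"] by simp
    show "positive (sets borel) ?m"
      by (simp add: positive_def)
    show "countably_additive (sets borel) ?m"
    proof (rule countably_additiveI)
      fix A :: "nat \<Rightarrow> real set"
      assume A: "range A \<subseteq> sets borel" "disjoint_family A"
      have "(\<Sum>i. ?m (A i)) = (\<Sum>i. emeasure N (A i)) + (\<Sum>i. ennreal c * indicator (A i) x)"
        by (rule suminf_add[symmetric]) auto
      also have "(\<Sum>i. emeasure N (A i)) = emeasure N (\<Union>i. A i)"
        using A sets by (intro suminf_emeasure) auto
      also have "(\<Sum>i. ennreal c * indicator (A i) x) = ennreal c * indicator (\<Union>i. A i) x"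
        using suminf_indicator[OF A(2), of x] by simp
      finally show "(\<Sum>i. ?m (A i)) = ?m (\<Union>i. A i)" .
    qed
  qed
  have "finite_measure M"
    using finite_measure.emeasure_finite[OF fin, of UNIV] eq[of UNIV]
    by (intro finite_measureI) (auto simp: sets_eq_imp_space_eq[of M borel])
  with eq show ?thesis
    by (intro exI[of _ M]) auto
qed

lemma integral_split_atom:
  fixes M :: "real measure" and f :: "real \<Rightarrow> complex"
  assumes "finite_measure M" and sets: "sets M = sets borel" and f: "integrable M f"
  shows "integral\<^sup>L M f = measure M {x} *\<^sub>R f x + integral\<^sup>L (density M (indicator (- {x}))) f"
proof -
  interpret finite_measure M by fact
  note [measurable_cong] = sets
  have [measurable]: "f \<in> borel_measurable borel"
    using borel_measurable_integrable[OF f] by simp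
  have "integral\<^sup>L M f = (\<integral>y. indicator {x} y *\<^sub>R f x + indicator (- {x}) y *\<^sub>R f y \<partial>M)"
    by (intro Bochner_Integration.integral_cong) (auto simp: indicator_def)
  also have "\<dots> = (\<integral>y. indicator {x} y *\<^sub>R f x \<partial>M) + (\<integral>y. indicator (- {x}) y *\<^sub>R f y \<partial>M)"
    using sets by (intro Bochner_Integration.integral_add integrable_mult_indicator f
        integrable_scaleR_left integrable_real_indicator) (auto simp: emeasure_eq_measure)
  also have "(\<integral>y. indicator {x} y *\<^sub>R f x \<partial>M) = measure M {x} *\<^sub>R f x"
    using sets by (subst integral_scaleR_left)
      (auto simp: sets_eq_imp_space_eq[OF sets] emeasure_eq_measure intro!: integrable_real_indicator)
  also have "(\<integral>y. indicator (- {x}) y *\<^sub>R f y \<partial>M) = integral\<^sup>L (density M (\<lambda>y. ennreal (indicator (- {x}) y))) f"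
    by (rule integral_density[symmetric]) auto
  finally show ?thesis
    by (simp add: ennreal_indicator)
qed

text \<open>Off \<open>x\<close> the two measures coincide, so splitting both integrals at
  \<open>x\<close> leaves only the atoms, whose masses differ by \<open>c\<close>.\<close>

lemma integral_add_atom:
  fixes M N :: "real measure" and f :: "real \<Rightarrow> complex"
  assumes M: "finite_measure M" "sets M = sets borel" and N: "finite_measure N" "sets N = sets borel"
    and eq: "\<And>A. A \<in> sets borel \<Longrightarrow> emeasure M A = emeasure N A + ennreal c * indicator A x"
    and c: "0 \<le> c" and f: "integrable M f" "integrable N f"
  shows "integral\<^sup>L M f = c *\<^sub>R f x + integral\<^sup>L N f"
proof -
  interpret M: finite_measure M by fact
  interpret N: finite_measure N by fact
  note [measurable_cong] = M(2) N(2)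
  have "density M (indicator (- {x})) = density N (indicator (- {x}))"
  proof (rule measure_eqI)
    fix A assume "A \<in> sets (density M (indicator (- {x})))"
    then have A: "A \<in> sets borel" using M by simp
    have ind: "(\<integral>\<^sup>+y. indicator (- {x}) y * indicator A y \<partial>K) = emeasure K (A - {x})"
      if "sets K = sets borel" for K :: "real measure"
    proof -
      have "(\<integral>\<^sup>+y. indicator (- {x}) y * indicator A y \<partial>K) = (\<integral>\<^sup>+y. indicator (A - {x}) y \<partial>K)"
        by (intro nn_integral_cong) (auto simp: indicator_def)
      then show ?thesis
        using that A by simp
    qed
    show "emeasure (density M (indicator (- {x}))) A = emeasure (density N (indicator (- {x}))) A"
      using M N A eq[of "A - {x}"] by (simp add: emeasure_density ind)
  qed (simp add: M N)
  moreover have "measure M {x} = measure N {x} + c"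
  proof -
    have "ennreal (measure M {x}) = ennreal (measure N {x} + c)"
      using eq[of "{x}"] c by (simp add: M.emeasure_eq_measure N.emeasure_eq_measure)
    then show ?thesis
      using c by (subst (asm) ennreal_inj) auto
  qed
  ultimately show ?thesis
    using integral_split_atom[OF M f(1), of x] integral_split_atom[OF N f(2), of x]
    by (simp add: scaleR_left_distrib)
qed

section \<open>Complete monotonicity of Laplace transforms of finite measures\<close>

lemma power_mult_exp_le:
  fixes w t :: real
  assumes w: "0 \<le> w" and t: "0 < t"
  shows "w ^ n * exp (- (w * t)) \<le> (real n / t) ^ n"
proof (cases "n = 0")
  case False
  \<comment> \<open>The bound uniform in \<open>w\<close> comes from
    \<open>(1 + w * t / n) ^ n <= exp (w * t)\<close>; the division is why \<open>n = 0\<close> is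
    treated apart.\<close>
  have "(w * t / real n) ^ n \<le> (1 + w * t / real n) ^ n"
    using w t by (intro power_mono) auto
  also have "\<dots> \<le> exp (w * t)"
    using w t False by (intro exp_ge_one_plus_x_over_n_power_n) (auto intro: order_trans[of _ 0])
  finally have "(w * t / real n) ^ n * (real n / t) ^ n \<le> exp (w * t) * (real n / t) ^ n"
    using t by (intro mult_right_mono) auto
  also have "(w * t / real n) ^ n * (real n / t) ^ n = w ^ n"
    using False t by (simp flip: power_mult_distrib)
  finally show ?thesis
    by (simp add: exp_minus pos_divide_le_eq mult.commute flip: divide_inverse)
qed (use assms in auto)

text \<open>Factoring out the larger exponential and using \<open>1 - exp (- y) <= y\<close> gives a
  mean value bound with the steepest slope beyond \<open>c\<close>. It provides a majorant for
  difference quotients that does not depend on the moving point.\<close>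

lemma exp_diff_le:
  fixes w x y c :: real
  assumes "0 \<le> w" "c \<le> x" "c \<le> y"
  shows "\<bar>exp (- (w * x)) - exp (- (w * y))\<bar> \<le> w * exp (- (w * c)) * \<bar>x - y\<bar>"
proof -
  have *: "\<bar>exp (- (w * x)) - exp (- (w * y))\<bar> \<le> w * exp (- (w * c)) * \<bar>x - y\<bar>"
    if "c \<le> x" "x \<le> y" for x y
  proof -
    have "exp (- (w * x)) - exp (- (w * y)) = exp (- (w * x)) * (1 - exp (- (w * (y - x))))"
      by (simp add: algebra_simps flip: exp_add)
    also have "\<dots> \<le> exp (- (w * c)) * (w * (y - x))"
      using that assms exp_ge_add_one_self[of "- (w * (y - x))"]
      by (intro mult_mono) (auto intro!: mult_left_mono)
    finally have "exp (- (w * x)) - exp (- (w * y)) \<le> w * exp (- (w * c)) * (y - x)"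
      by (simp add: mult_ac)
    moreover have "exp (- (w * y)) \<le> exp (- (w * x))"
      using that assms by (simp add: mult_left_mono)
    ultimately show ?thesis
      using that by simp
  qed
  show ?thesis
    using *[of x y] *[of y x] assms by (cases "x \<le> y") (auto simp: abs_minus_commute)
qed

context
  fixes M :: "real measure"
  assumes finM: "finite_measure M" and setsM: "sets M = sets borel" and nullM: "emeasure M {..<0} = 0"
begin

interpretation finite_measure M by (rule finM)

lemma AE_nonneg: "AE w in M. 0 \<le> w"
  using setsM nullM by (intro AE_I[of _ _ "{..<0}"]) auto

lemma integrable_power_mult_exp:
  assumes t: "0 < t"
  shows "integrable M (\<lambda>w. w ^ n * exp (- (w * t)))"
proof (rule integrable_const_bound)
  note [measurable_cong] = setsM
  show "(\<lambda>w. w ^ n * exp (- (w * t))) \<in> borel_measurable M"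
    by measurable
  show "AE w in M. norm (w ^ n * exp (- (w * t))) \<le> (real n / t) ^ n"
    using AE_nonneg by eventually_elim (use power_mult_exp_le[OF _ t] in \<open>simp add: abs_mult\<close>)
qed

text \<open>Differentiation under the integral. Keeping the moving point above \<open>t / 2\<close>
  makes \<open>w ^ Suc n * exp (- (w * (t / 2)))\<close> an integrable majorant of all difference
  quotients.\<close>

lemma has_real_derivative_laplace:
  assumes t: "0 < t"
  shows "((\<lambda>t. \<integral>w. (- w) ^ n * exp (- (w * t)) \<partial>M) has_real_derivative
    (\<integral>w. (- w) ^ Suc n * exp (- (w * t)) \<partial>M)) (at t)"
proof -
  note [measurable_cong] = setsM
  let ?f = "\<lambda>t w. (- w) ^ n * exp (- (w * t))"
  have int: "integrable M (?f x)" if "0 < x" for x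
  proof -
    have "?f x = (\<lambda>w. (- 1) ^ n * (w ^ n * exp (- (w * x))))"
      by (simp add: fun_eq_iff flip: mult.assoc power_mult_distrib)
    then show ?thesis
      using integrable_power_mult_exp[OF that, of n] by simp
  qed
  have "((\<lambda>x. ((\<integral>w. ?f x w \<partial>M) - (\<integral>w. ?f t w \<partial>M)) / (x - t)) \<longlongrightarrow>
      (\<integral>w. (- w) ^ Suc n * exp (- (w * t)) \<partial>M)) (at t within {t / 2<..})"
    unfolding tendsto_at_iff_sequentially comp_def
  proof (intro allI impI)
    fix X :: "nat \<Rightarrow> real"
    assume X: "\<forall>i. X i \<in> {t / 2<..} - {t}" and lim: "X \<longlonglongrightarrow> t"
    then have X0: "t / 2 < X i" "X i \<noteq> t" for i by auto
    have "(\<lambda>i. \<integral>w. (?f (X i) w - ?f t w) / (X i - t) \<partial>M) \<longlonglongrightarrow> (\<integral>w. (- w) ^ Suc n * exp (- (w * t)) \<partial>M)"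
    proof (rule integral_dominated_convergence)
      show "integrable M (\<lambda>w. w ^ Suc n * exp (- (w * (t / 2))))"
        using t by (intro integrable_power_mult_exp) auto
      show "AE w in M. (\<lambda>i. (?f (X i) w - ?f t w) / (X i - t)) \<longlonglongrightarrow> (- w) ^ Suc n * exp (- (w * t))"
      proof (rule AE_I2)
        fix w
        have "((\<lambda>x. ?f x w) has_real_derivative (- w) ^ Suc n * exp (- (w * t))) (at t)"
          by (auto intro!: derivative_eq_intros)
        then have "((\<lambda>x. (?f x w - ?f t w) / (x - t)) \<longlongrightarrow> (- w) ^ Suc n * exp (- (w * t))) (at t)"
          by (simp only: has_field_derivative_iff)
        then show "(\<lambda>i. (?f (X i) w - ?f t w) / (X i - t)) \<longlonglongrightarrow> (- w) ^ Suc n * exp (- (w * t))"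
          by (rule filterlim_compose) (use lim X0(2) in \<open>auto simp: filterlim_at\<close>)
      qed
      show "AE w in M. norm ((?f (X i) w - ?f t w) / (X i - t)) \<le> w ^ Suc n * exp (- (w * (t / 2)))" for i
        using AE_nonneg
      proof eventually_elim
        case (elim w)
        have "\<bar>?f (X i) w - ?f t w\<bar> = w ^ n * \<bar>exp (- (w * X i)) - exp (- (w * t))\<bar>"
          using elim by (simp add: abs_mult power_abs flip: right_diff_distrib)
        also have "\<dots> \<le> w ^ n * (w * exp (- (w * (t / 2))) * \<bar>X i - t\<bar>)"
          using elim X0[of i] t by (intro mult_left_mono exp_diff_le) auto
        finally show ?case
          using X0(2)[of i] by (simp add: pos_divide_le_eq mult_ac)
      qed
    qed measurable
    moreover have "(\<integral>w. (?f (X i) w - ?f t w) / (X i - t) \<partial>M) = ((\<integral>w. ?f (X i) w \<partial>M) - (\<integral>w. ?f t w \<partial>M)) / (X i - t)" for i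
      using int[of "X i"] int[of t] X0(1)[of i] t by simp
    ultimately show "(\<lambda>i. ((\<integral>w. ?f (X i) w \<partial>M) - (\<integral>w. ?f t w \<partial>M)) / (X i - t)) \<longlonglongrightarrow> (\<integral>w. (- w) ^ Suc n * exp (- (w * t)) \<partial>M)"
      by (simp only:)
  qed
  then show ?thesis
    using t by (simp add: has_field_derivative_iff at_within_open[of t "{t / 2<..}"])
qed

lemma completely_monotone_laplace:
  assumes g: "\<And>t. 0 < t \<Longrightarrow> g t = (\<integral>w. exp (- (w * t)) \<partial>M)"
  shows "completely_monotone g"
proof -
  let ?I = "\<lambda>n t. \<integral>w. (- w) ^ n * exp (- (w * t)) \<partial>M"
  \<comment> \<open>The iterated derivatives are identified on the positive half-line only; its
    openness suffices to pass to the next derivative.\<close>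
  have transfer: "(f has_real_derivative ?I (Suc n) t) (at t)"
    if "\<And>t. 0 < t \<Longrightarrow> f t = ?I n t" "0 < t" for f n t
    using has_real_derivative_laplace[OF that(2)]
    by (rule has_field_derivative_transform_within_open[of _ _ _ "{0<..}"]) (use that in auto)
  have eq: "(deriv ^^ n) g t = ?I n t" if "0 < t" for n t
    using that
  proof (induction n arbitrary: t)
    case 0
    then show ?case by (simp add: g)
  next
    case (Suc n)
    then show ?case
      using DERIV_imp_deriv[OF transfer[OF Suc.IH Suc.prems]] by simp
  qed
  show ?thesis
    unfolding completely_monotone_def
  proof (intro conjI allI impI)
    fix n and t :: real assume t: "0 < t"
    show "(deriv ^^ n) g differentiable at t"
      using transfer[OF eq t] real_differentiable_def by blast
    \<comment> \<open>The sign cancels against the powers of \<open>- w\<close>, leaving an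
      integrand nonnegative for almost all \<open>w\<close>.\<close>
    have "(- 1) ^ n * ?I n t = (\<integral>w. (- 1) ^ n * ((- w) ^ n * exp (- (w * t))) \<partial>M)"
      by simp
    also have "\<dots> = (\<integral>w. w ^ n * exp (- (w * t)) \<partial>M)"
      by (intro Bochner_Integration.integral_cong refl) (simp flip: mult.assoc power_mult_distrib)
    also have "0 \<le> \<dots>"
      using AE_nonneg by (intro integral_nonneg_AE) auto
    finally show "0 \<le> (- 1) ^ n * (deriv ^^ n) g t"
      using eq[OF t] by simp
  qed
qed

end

section \<open>The quotient \<open>g z / z\<close> as a Laplace transform\<close>

lemma norm_exp_minus_le_1: "0 \<le> w \<Longrightarrow> 0 < Re z \<Longrightarrow> norm (exp (- (complex_of_real w * z))) \<le> 1"
  by simp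

lemma integrable_exp_laplace:
  fixes M :: "real measure"
  assumes M: "finite_measure M" "sets M = sets borel" "AE w in M. 0 \<le> w" and z: "0 < Re z"
  shows "integrable M (\<lambda>w. exp (- (complex_of_real w * z)))"
proof -
  interpret finite_measure M by fact
  note [measurable_cong] = M(2)
  show ?thesis
    using M(3) norm_exp_minus_le_1[OF _ z]
    by (intro integrable_const_bound[where B = 1]) (auto elim!: eventually_mono)
qed

text \<open>The fundamental theorem of calculus with antiderivative \<open>?F\<close>. The
  \<open>max 0\<close> is inactive for \<open>x\<close> in \<open>[0, 1]\<close> and
  \<open>s > 0\<close>; it matches the image measure used next.\<close>

lemma integral_exp_Icc:
  assumes s: "0 < s" and z: "0 < Re z"
  shows "s *\<^sub>R (\<integral>x. indicator {0..1::real} x *\<^sub>R exp (- (complex_of_real (max 0 (x * s)) * z)) \<partial>lborel)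
    = (1 - exp (- (complex_of_real s * z))) / z"
proof -
  have z0: "z \<noteq> 0" using z by auto
  let ?F = "\<lambda>x::real. - (exp (- (complex_of_real (x * s) * z)) / (of_real s * z))"
  have "(\<integral>x. indicator {0..1::real} x *\<^sub>R exp (- (complex_of_real (x * s) * z)) \<partial>lborel) = ?F 1 - ?F 0"
  proof (rule integral_FTC_Icc)
    fix x :: real
    have "((\<lambda>y. - (exp (- (y * of_real s * z)) / (of_real s * z))) has_field_derivative
        exp (- (complex_of_real (x * s) * z))) (at (complex_of_real x))"
      using s z0 by (auto intro!: derivative_eq_intros)
    from has_vector_derivative_real_field[OF this, of "{0..1}"]
    show "(?F has_vector_derivative exp (- (complex_of_real (x * s) * z))) (at x within {0..1})"
      by simp
  qed (auto intro!: continuous_intros)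
  moreover have "(\<integral>x. indicator {0..1::real} x *\<^sub>R exp (- (complex_of_real (max 0 (x * s)) * z)) \<partial>lborel)
      = (\<integral>x. indicator {0..1::real} x *\<^sub>R exp (- (complex_of_real (x * s) * z)) \<partial>lborel)"
    using s by (intro Bochner_Integration.integral_cong) (auto simp: indicator_def max_def mult_less_0_iff)
  ultimately show ?thesis
    using s z0 by (simp add: scaleR_conv_of_real field_simps)
qed

text \<open>With \<open>\<nu>(ds) = s \<mu>(ds)\<close> finite, \<open>(1 - exp (- s z)) / (s z)\<close> is the average of \<open>exp (- x s z)\<close>
  over \<open>x \<in> [0, 1]\<close>, so \<open>(g z - b z) / z\<close> is the Laplace transform of the image of \<open>dx \<nu>(ds)\<close> under
  \<open>(x, s) \<mapsto> x s\<close>; the truncation at 0 only makes the integrand bounded everywhere.\<close>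

lemma exists_laplace_representation:
  assumes \<mu>: "bernstein_triple 0 b \<mu>" and int: "integrable \<mu> (\<lambda>s. s)"
  obtains M where "finite_measure M" "sets M = sets borel" "emeasure M {..<0} = 0"
    "\<And>z. 0 < Re z \<Longrightarrow> bernstein_fun 0 b \<mu> z = z * (\<integral>w. exp (- (complex_of_real w * z)) \<partial>M)"
proof -
  note sets\<mu> [measurable_cong] = bernstein_tripleD(3)[OF \<mu>]
  define \<nu> where "\<nu> = density \<mu> (\<lambda>s. ennreal s)"
  define U where "U = density lborel (\<lambda>x::real. ennreal (indicator {0..1} x))"
  define N where "N = distr (U \<Otimes>\<^sub>M \<nu>) borel (\<lambda>(x, s). max 0 (x * s))"
  have [measurable_cong]: "sets \<nu> = sets borel" "sets U = sets borel"
    using sets\<mu> by (simp_all add: \<nu>_def U_def)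
  interpret \<nu>: finite_measure \<nu>
  proof (rule finite_measureI)
    have "emeasure \<nu> (space \<nu>) = (\<integral>\<^sup>+s. ennreal s \<partial>\<mu>)"
      unfolding \<nu>_def by (simp add: emeasure_density)
    also have "\<dots> \<le> (\<integral>\<^sup>+s. ennreal (norm s) \<partial>\<mu>)"
      by (intro nn_integral_mono ennreal_leI) simp
    also have "\<dots> < \<infinity>"
      using int unfolding integrable_iff_bounded by blast
    finally show "emeasure \<nu> (space \<nu>) \<noteq> \<infinity>" by simp
  qed
  interpret U: finite_measure U
    by (rule finite_measureI) (simp add: U_def emeasure_density ennreal_indicator)
  interpret P: pair_sigma_finite U \<nu> ..
  interpret Q: finite_measure "U \<Otimes>\<^sub>M \<nu>"
    by (rule finite_measure_pair_measure[OF \<nu>.finite_measure_axioms U.finite_measure_axioms])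
  have N: "finite_measure N" "sets N = sets borel"
    unfolding N_def by (rule Q.finite_measure_distr, measurable)
  have N0: "emeasure N {..<0} = 0"
  proof -
    have "(\<lambda>(x, s). max 0 (x * s)) -` {..<0::real} = {}" by auto
    then show ?thesis
      unfolding N_def by (subst emeasure_distr) auto
  qed
  have posN: "AE w in N. 0 \<le> w"
    using N N0 by (intro AE_I[of _ _ "{..<0}"]) auto
  have IN: "z * (\<integral>w. exp (- (complex_of_real w * z)) \<partial>N) = (\<integral>s. 1 - exp (- (complex_of_real s * z)) \<partial>\<mu>)"
    if z: "0 < Re z" for z
  proof -
    have z0: "z \<noteq> 0" using z by auto
    let ?e = "\<lambda>x s. exp (- (complex_of_real (max 0 (x * s)) * z))"
    have int_e: "integrable (U \<Otimes>\<^sub>M \<nu>) (case_prod ?e)"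
    proof (rule Q.integrable_const_bound)
      have "norm (?e x s) \<le> 1" for x s
        by (rule norm_exp_minus_le_1[OF _ z]) simp
      then show "AE p in U \<Otimes>\<^sub>M \<nu>. norm (case_prod ?e p) \<le> 1"
        by (simp only: case_prod_unfold) simp
      show "case_prod ?e \<in> borel_measurable (U \<Otimes>\<^sub>M \<nu>)"
        by measurable
    qed
    have "(\<integral>w. exp (- (complex_of_real w * z)) \<partial>N) = integral\<^sup>L (U \<Otimes>\<^sub>M \<nu>) (case_prod ?e)"
      unfolding N_def by (subst integral_distr) (simp_all add: case_prod_unfold)
    also have "\<dots> = (\<integral>s. (\<integral>x. ?e x s \<partial>U) \<partial>\<nu>)"
      by (rule P.integral_snd[OF int_e, symmetric])
    also have "\<dots> = (\<integral>s. (\<integral>x. indicator {0..1::real} x *\<^sub>R ?e x s \<partial>lborel) \<partial>\<nu>)"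
      unfolding U_def by (subst integral_density) auto
    also have "\<dots> = (\<integral>s. s *\<^sub>R (\<integral>x. indicator {0..1::real} x *\<^sub>R ?e x s \<partial>lborel) \<partial>\<mu>)"
      unfolding \<nu>_def using bernstein_tripleD(4)[OF \<mu>]
      by (intro integral_density) (auto elim!: eventually_mono)
    also have "\<dots> = (\<integral>s. (1 - exp (- (complex_of_real s * z))) / z \<partial>\<mu>)"
      using bernstein_tripleD(4)[OF \<mu>]
      by (intro integral_cong_AE) (auto elim!: eventually_mono simp: integral_exp_Icc[OF _ z])
    also have "\<dots> = (\<integral>s. 1 - exp (- (complex_of_real s * z)) \<partial>\<mu>) / z"
      by (rule integral_divide_zero)
    finally show ?thesis
      using z0 by simp
  qed
  have b: "0 \<le> b"
    using bernstein_tripleD(2)[OF \<mu>] .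
  \<comment> \<open>The atom of mass \<open>b\<close> at 0 adds the constant \<open>b\<close> to the
    transform, hence the missing term \<open>b * z\<close> after multiplication by
    \<open>z\<close>.\<close>
  obtain M where M: "finite_measure M" "sets M = sets borel"
    "\<And>A. A \<in> sets borel \<Longrightarrow> emeasure M A = emeasure N A + ennreal b * indicator A 0"
    using exists_measure_add_atom[OF N b, of 0] by blast
  have M0: "emeasure M {..<0} = 0"
    using M(3)[of "{..<0}"] N0 by simp
  then have posM: "AE w in M. 0 \<le> w"
    using M by (intro AE_I[of _ _ "{..<0}"]) auto
  have "bernstein_fun 0 b \<mu> z = z * (\<integral>w. exp (- (complex_of_real w * z)) \<partial>M)" if z: "0 < Re z" for z
  proof -
    have "(\<integral>w. exp (- (complex_of_real w * z)) \<partial>M) = of_real b + (\<integral>w. exp (- (complex_of_real w * z)) \<partial>N)"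
      using integral_add_atom[OF M(1,2) N M(3) b integrable_exp_laplace[OF M(1,2) posM z]
          integrable_exp_laplace[OF N posN z]]
      by (simp add: scaleR_conv_of_real)
    then show ?thesis
      using IN[OF z] by (simp add: bernstein_fun_def algebra_simps)
  qed
  with M(1,2) M0 show ?thesis
    by (rule that)
qed

lemma W_plus_laplace:
  assumes "finite_measure M" "sets M = sets borel" "emeasure M {..<0} = 0"
  shows "W_plus (\<lambda>z. \<integral>w. exp (- (complex_of_real w * z)) \<partial>M)"
  unfolding W_plus_def using assms
  by (intro exI[of _ M] exI[of _ "\<lambda>_. 1"]) (auto simp: finite_measure.integrable_const)

lemma bounded_iff_W_plus:
  assumes \<mu>: "bernstein_triple a b \<mu>"
  shows "bounded ((\<lambda>t. t * rate_fun a b \<mu> t) ` {0<..}) \<longleftrightarrow>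
    a = 0 \<and> (\<exists>h. W_plus h \<and> (\<forall>z. Re z > 0 \<longrightarrow> bernstein_fun a b \<mu> z = z * h z))"
    (is "?L \<longleftrightarrow> a = 0 \<and> (\<exists>h. ?P h)")
proof (intro iffI conjI)
  assume L: ?L
  show a: "a = 0"
    using integrable_of_bounded(1)[OF \<mu> L] .
  obtain M where "finite_measure M" "sets M = sets borel" "emeasure M {..<0} = 0"
    "\<And>z. 0 < Re z \<Longrightarrow> bernstein_fun 0 b \<mu> z = z * (\<integral>w. exp (- (complex_of_real w * z)) \<partial>M)"
    using exists_laplace_representation[OF _ integrable_of_bounded(2)[OF \<mu> L], of b] \<mu> a by blast
  then show "\<exists>h. ?P h"
    using W_plus_laplace a by blast
next
  assume "a = 0 \<and> (\<exists>h. ?P h)"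
  then obtain h where h: "W_plus h" "\<And>z. Re z > 0 \<Longrightarrow> bernstein_fun a b \<mu> z = z * h z" by blast
  obtain C where C: "\<And>z. 0 < Re z \<Longrightarrow> norm (h z) \<le> C"
    using W_plus_bounded[OF h(1)] by blast
  show ?L
    unfolding bounded_iff
  proof (intro exI ballI)
    fix y assume "y \<in> (\<lambda>t. t * rate_fun a b \<mu> t) ` {0<..}"
    then obtain t where t: "0 < t" "y = t * rate_fun a b \<mu> t" by auto
    \<comment> \<open>Evaluating at \<open>1 / t\<close> turns the bound on \<open>h\<close> into
      \<open>rate_fun a b \<mu> t <= 2 * C / t\<close>.\<close>
    have "rate_fun a b \<mu> t \<le> 2 * Re (bernstein_fun a b \<mu> (complex_of_real (1 / t)))"
      using rate_fun_inverse_le[OF \<mu>, of "1 / t"] t by simp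
    also have "Re (bernstein_fun a b \<mu> (complex_of_real (1 / t))) = 1 / t * Re (h (complex_of_real (1 / t)))"
      using h(2)[of "complex_of_real (1 / t)"] t by simp
    also have "\<dots> \<le> 1 / t * C"
      using t C[of "complex_of_real (1 / t)"]
      by (intro mult_left_mono order_trans[OF complex_Re_le_cmod]) auto
    finally have "t * rate_fun a b \<mu> t \<le> 2 * C"
      using t by (simp add: field_simps)
    moreover have "0 \<le> t * rate_fun a b \<mu> t"
      using t integral_min_nonneg[OF \<mu> t(1)] bernstein_tripleD(1,2)[OF \<mu>] by (simp add: mult_rate_fun)
    ultimately show "norm y \<le> 2 * C"
      using t by simp
  qed
qed

text \<open>Since \<open>z\<close> is nonzero, \<open>h\<close> is determined on the half-plane and
  agrees there with the transform of the positive measure from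
  \<open>exists_laplace_representation\<close>, which is real at real points.\<close>

lemma completely_monotone_quotient:
  assumes \<mu>: "bernstein_triple a b \<mu>"
    and bdd: "bounded ((\<lambda>t. t * rate_fun a b \<mu> t) ` {0<..})"
    and h: "\<And>z. Re z > 0 \<Longrightarrow> bernstein_fun a b \<mu> z = z * h z"
  shows "\<And>t. 0 < t \<Longrightarrow> Im (h (complex_of_real t)) = 0"
    and "completely_monotone (\<lambda>t. Re (h (complex_of_real t)))"
proof -
  have a: "a = 0"
    using integrable_of_bounded(1)[OF \<mu> bdd] .
  obtain M where M: "finite_measure M" "sets M = sets borel" "emeasure M {..<0} = 0"
    and eq: "\<And>z. 0 < Re z \<Longrightarrow> bernstein_fun 0 b \<mu> z = z * (\<integral>w. exp (- (complex_of_real w * z)) \<partial>M)"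
    using exists_laplace_representation[OF _ integrable_of_bounded(2)[OF \<mu> bdd], of b] \<mu> a by blast
  have ht: "h (complex_of_real t) = complex_of_real (\<integral>w. exp (- (w * t)) \<partial>M)" if "0 < t" for t
  proof -
    have "of_real t * h (of_real t) = of_real t * (\<integral>w. exp (- (complex_of_real w * of_real t)) \<partial>M)"
      using eq[of "of_real t"] h[of "of_real t"] that a by simp
    then have "h (of_real t) = (\<integral>w. complex_of_real (exp (- (w * t))) \<partial>M)"
      using that by (simp flip: exp_of_real)
    then show ?thesis
      by (simp only: integral_complex_of_real)
  qed
  then show "Im (h (complex_of_real t)) = 0" if "0 < t" for t
    using that by simp
  show "completely_monotone (\<lambda>t. Re (h (complex_of_real t)))"
    using ht by (intro completely_monotone_laplace[OF M]) simp
qed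

section \<open>The characterisation of rate functions and properties (a), (b), (c)\<close>

theorem theorem3p2:
  fixes r :: "real \<Rightarrow> real"
  assumes rpos: "\<forall>t>0. r t > 0"
  shows "((\<exists>a b \<mu>. bernstein_triple a b \<mu> \<and>
              (\<exists>z. Re z > 0 \<and> bernstein_fun a b \<mu> z \<noteq> 0) \<and>
              (\<forall>t>0. r t = rate_fun a b \<mu> t))
          \<longleftrightarrow>
          ((\<forall>t>0. t * r t > 0) \<and> mono_on {0<..} (\<lambda>t. t * r t) \<and>
           concave_on {0<..} (\<lambda>t. t * r t)))
      \<and>
      (\<forall>a b \<mu>. bernstein_triple a b \<mu> \<and>
              (\<exists>z. Re z > 0 \<and> bernstein_fun a b \<mu> z \<noteq> 0) \<and>
              (\<forall>t>0. r t = rate_fun a b \<mu> t) \<longrightarrow>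
         (continuous_on {0<..} r \<and> antimono_on {0<..} r \<and> (r \<longlongrightarrow> a / 2) at_top) \<and>
         ((\<lambda>t. t * r t) \<longlongrightarrow> b) (at_right 0) \<and>
         ((bounded ((\<lambda>t. t * r t) ` {0<..}) \<longleftrightarrow>
             a = 0 \<and> (\<exists>h. W_plus h \<and> (\<forall>z. Re z > 0 \<longrightarrow> bernstein_fun a b \<mu> z = z * h z))) \<and>
          (\<forall>h. a = 0 \<and> W_plus h \<and> (\<forall>z. Re z > 0 \<longrightarrow> bernstein_fun a b \<mu> z = z * h z) \<longrightarrow>
             (\<forall>t>0. Im (h (complex_of_real t)) = 0) \<and>
             completely_monotone (\<lambda>t. Re (h (complex_of_real t))))))"
    (is "(?i \<longleftrightarrow> ?ii) \<and> ?rest")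
proof (intro conjI)
  show "?i \<longleftrightarrow> ?ii"
  proof
    assume ?i
    then obtain a b \<mu> where \<mu>: "bernstein_triple a b \<mu>" and r: "\<And>t. 0 < t \<Longrightarrow> r t = rate_fun a b \<mu> t"
      by blast
    have mono: "mono_on {0<..} (\<lambda>t. t * r t)"
      using mono_on_mult_rate_fun[OF \<mu>] by (simp add: mono_on_def r)
    have "concave_on {0<..} (\<lambda>t. t * rate_fun a b \<mu> t)"
      by (rule concave_on_mult_rate_fun[OF \<mu>])
    moreover have "0 < u * x + v * y" if "0 < x" "0 < y" "0 \<le> u" "0 \<le> v" "u + v = 1" for u v x y :: real
      using that by (cases "u = 0") (auto intro: add_pos_nonneg)
    ultimately have "concave_on {0<..} (\<lambda>t. t * r t)"
      unfolding concave_on_iff by (auto simp: r)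
    with mono rpos show ?ii by simp
  next
    assume ?ii
    then obtain a b \<mu> where \<mu>: "bernstein_triple a b \<mu>"
      and eq: "\<And>t. 0 < t \<Longrightarrow> t * r t = t * rate_fun a b \<mu> t"
      using exists_bernstein_triple[of "\<lambda>t. t * r t"] less_imp_le by metis
    then have r: "r t = rate_fun a b \<mu> t" if "0 < t" for t
      using that by auto
    \<comment> \<open>If \<open>g\<close> vanished on the half-plane,
      \<open>rate_fun_1_nonpos\<close> would contradict \<open>r 1 > 0\<close>.\<close>
    have "\<exists>z. Re z > 0 \<and> bernstein_fun a b \<mu> z \<noteq> 0"
      using rate_fun_1_nonpos[OF \<mu>] rpos r[of 1] by (metis not_less zero_less_one)
    with \<mu> r show ?i by blast
  qed
  show ?rest
  proof (intro allI impI, elim conjE)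
    fix a b \<mu>
    assume \<mu>: "bernstein_triple a b \<mu>" and r': "\<forall>t>0. r t = rate_fun a b \<mu> t"
    then have r: "r t = rate_fun a b \<mu> t" if "0 < t" for t
      using that by blast
    have "continuous_on {0<..} r"
      using continuous_on_rate_fun[OF \<mu>] by (rule continuous_on_eq) (simp add: r)
    moreover have "antimono_on {0<..} r"
      using antimono_on_rate_fun[OF \<mu>] by (simp add: monotone_on_def r)
    moreover have "(r \<longlongrightarrow> a / 2) at_top"
      using tendsto_rate_fun_at_top[OF \<mu>]
    proof (rule Lim_transform_eventually)
      show "\<forall>\<^sub>F t in at_top. rate_fun a b \<mu> t = r t"
        using eventually_gt_at_top[of 0] by eventually_elim (simp add: r)
    qed
    moreover have "((\<lambda>t. t * r t) \<longlongrightarrow> b) (at_right 0)"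
      using tendsto_mult_rate_fun_at_right[OF \<mu>]
      by (rule Lim_transform_eventually)
        (use eventually_at_right_less[of "0::real"] in \<open>auto elim!: eventually_mono simp: r\<close>)
    moreover have "(\<lambda>t. t * r t) ` {0<..} = (\<lambda>t. t * rate_fun a b \<mu> t) ` {0<..}"
      by (intro image_cong) (auto simp: r)
    then have "bounded ((\<lambda>t. t * r t) ` {0<..}) \<longleftrightarrow>
        a = 0 \<and> (\<exists>h. W_plus h \<and> (\<forall>z. Re z > 0 \<longrightarrow> bernstein_fun a b \<mu> z = z * h z))"
      using bounded_iff_W_plus[OF \<mu>] by simp
    moreover have "(\<forall>t>0. Im (h (complex_of_real t)) = 0) \<and> completely_monotone (\<lambda>t. Re (h (complex_of_real t)))"
      if "a = 0 \<and> W_plus h \<and> (\<forall>z. Re z > 0 \<longrightarrow> bernstein_fun a b \<mu> z = z * h z)" for h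
    proof -
      \<comment> \<open>The given \<open>h\<close> itself yields boundedness through the equivalence
        in (c), which makes the positive representing measure available.\<close>
      have "bounded ((\<lambda>t. t * rate_fun a b \<mu> t) ` {0<..})"
        using bounded_iff_W_plus[OF \<mu>] that by blast
      from completely_monotone_quotient[OF \<mu> this, of h] that show ?thesis by blast
    qed
    ultimately show "(continuous_on {0<..} r \<and> antimono_on {0<..} r \<and> (r \<longlongrightarrow> a / 2) at_top) \<and>
         ((\<lambda>t. t * r t) \<longlongrightarrow> b) (at_right 0) \<and>
         ((bounded ((\<lambda>t. t * r t) ` {0<..}) \<longleftrightarrow>
             a = 0 \<and> (\<exists>h. W_plus h \<and> (\<forall>z. Re z > 0 \<longrightarrow> bernstein_fun a b \<mu> z = z * h z))) \<and>
          (\<forall>h. a = 0 \<and> W_plus h \<and> (\<forall>z. Re z > 0 \<longrightarrow> bernstein_fun a b \<mu> z = z * h z) \<longrightarrow>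
             (\<forall>t>0. Im (h (complex_of_real t)) = 0) \<and>
             completely_monotone (\<lambda>t. Re (h (complex_of_real t)))))"
      by blast
  qed
qed

end
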